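(* Let $2\le \ell<k$ and $n\ge 1000k^{8}$ be integers, and let $G$ be an $n$-vertex graph that is $\{C_3,C_5,\dots,C_{2\ell-1},C_{2k+1}\}$-free. (i) If $\ell>(2k-1)/8$ and $\delta(G)\ge \frac{2n}{2k+3}$, then either $G$ is bipartite, or $\delta(G)=\frac{2n}{2k+3}$ and $G=C_{2k+3}(n/(2k+3))$. (ii) If $2\le \ell<(2k-1)/8$ and $\delta(G)\ge \frac{n}{2(2\ell+1)}$, then either $G$ is bipartite, or $\delta(G)=\frac{n}{2(2\ell+1)}$ and $G=BC_{2\ell+1}(n)$.
   Context: All graphs are finite, simple and undirected; equality of graphs is up to isomorphism. $\delta(G)$ is the minimum degree of $G$. $C_m$ denotes the cycle with $m$ vertices. For a family $\mathcal{C}$ of graphs, a graph is $\mathcal{C}$-free if it contains no member of $\mathcal{C}$ as a (not necessarily induced) subgraph. The family $\{C_3,C_5,\dots,C_{2\ell-1},C_{2k+1}\}$ consists of all odd cycles of length at most $2\ell-1$ together with $C_{2k+1}$. $BC_{2\ell+1}(n)$ denotes the $n$-vertex graph obtained by taking $2\ell+1$ vertex-disjoint copies of the complete bipartite graph $K_{n/(2(2\ell+1)),\,n/(2(2\ell+1))}$, selecting one vertex in each copy, and adding edges among the selected vertices so that they form a cycle of length $2\ell+1$ (defined when $2(2\ell+1)$ divides $n$). $C_{2k+3}(n/(2k+3))$ denotes the balanced blow-up of $C_{2k+3}$ on $n$ vertices: each vertex $v_i$ of $C_{2k+3}$ is replaced by an independent set $V_i$ of size $n/(2k+3)$, and every vertex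 of $V_i$ is joined to every vertex of $V_j$ exactly when $v_iv_j\in E(C_{2k+3})$ (defined when $2k+3$ divides $n$). *)

theory Defs
  imports Complex_Main "Graph_Theory.Graph_Theory"
begin

text \<open>
  A finite simple undirected graph is a \<^locale>\<open>pair_graph\<close>: a finite loop-free symmetric
  digraph without parallel arcs, where each edge is represented by its two opposite arcs. In
  particular the degree of a vertex is its \<^const>\<open>out_degree\<close>.
\<close>

definition min_degree :: "'a pair_pre_digraph \<Rightarrow> nat" where
  "min_degree G = Min (out_degree (with_proj G) ` pverts G)"

definition bipartite :: "'a pair_pre_digraph \<Rightarrow> bool" where
  "bipartite G \<longleftrightarrow> (\<exists>A B. A \<union> B = pverts G \<and> A \<inter> B = {} \<and> parcs G \<subseteq> A \<times> B \<union> B \<times> A)"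

definition isomorphic :: "'a pair_pre_digraph \<Rightarrow> 'b pair_pre_digraph \<Rightarrow> bool" where
  "isomorphic G H \<longleftrightarrow> digraph_iso (with_proj G) (with_proj H)"

definition contains_graph :: "'a pair_pre_digraph \<Rightarrow> 'b pair_pre_digraph \<Rightarrow> bool" where
  "contains_graph G C \<longleftrightarrow> (\<exists>H. subgraph (with_proj H) (with_proj G) \<and> isomorphic H C)"

definition family_free :: "'b pair_pre_digraph set \<Rightarrow> 'a pair_pre_digraph \<Rightarrow> bool" where
  "family_free \<C> G \<longleftrightarrow> (\<forall>C\<in>\<C>. \<not> contains_graph G C)"

text \<open>The cycle $C_m$; only meaningful for $m \geq 3$.\<close>
definition cycle_graph :: "nat \<Rightarrow> nat pair_pre_digraph" where
  "cycle_graph m = \<lparr> pverts = {..<m},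
     parcs = {(i, j). i < m \<and> j < m \<and> (j = (i + 1) mod m \<or> i = (j + 1) mod m)} \<rparr>"

text \<open>The family $\{C_3, C_5, \dots, C_{2\ell-1}, C_{2k+1}\}$.\<close>
definition odd_cycle_family :: "nat \<Rightarrow> nat \<Rightarrow> nat pair_pre_digraph set" where
  "odd_cycle_family l k =
     {cycle_graph (2 * i + 1) | i. 1 \<le> i \<and> i \<le> l - 1} \<union> {cycle_graph (2 * k + 1)}"

text \<open>
  The blow-up of \<open>H\<close> in which the vertex \<open>v\<close> becomes the independent set \<open>{v} \<times> {..<t}\<close>.
\<close>
definition blow_up :: "'a pair_pre_digraph \<Rightarrow> nat \<Rightarrow> ('a \<times> nat) pair_pre_digraph" where
  "blow_up H t = \<lparr> pverts = pverts H \<times> {..<t},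
     parcs = {((u, i), (v, j)). (u, v) \<in> parcs H \<and> i < t \<and> j < t} \<rparr>"

text \<open>
  $BC_m(n)$ for $m = 2\ell+1$, to be used only when \<open>2 * m\<close> divides \<open>n\<close>.
  The vertex \<open>(c, s, i)\<close> is the \<open>i\<close>-th vertex on side \<open>s\<close> of the \<open>c\<close>-th complete bipartite graph;
  the selected vertex of the \<open>c\<close>-th copy is \<open>(c, False, 0)\<close> (any other choice gives an isomorphic
  graph).
\<close>
definition BC :: "nat \<Rightarrow> nat \<Rightarrow> (nat \<times> bool \<times> nat) pair_pre_digraph" where
  "BC m n = (let V = {..<m} \<times> UNIV \<times> {..<n div (2 * m)} in
     \<lparr> pverts = V,
       parcs = {((c, s, i), (d, r, j)). (c, s, i) \<in> V \<and> (d, r, j) \<in> V \<and> c = d \<and> s \<noteq> r} \<union>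
         {((c, False, 0), (d, False, 0)) | c d.
            (c, False, 0) \<in> V \<and> (d, False, 0) \<in> V \<and> (c, d) \<in> parcs (cycle_graph m)} \<rparr>)"

end

theory Submission
  imports Defs
begin

text \<open>
  Let \<open>v\<close> be a shortest odd closed walk of a non-bipartite graph, of length \<open>N = 2 * m + 1\<close>. It is an
  induced cycle, and by the forbidden cycles \<open>m \<ge> l\<close> and \<open>m \<noteq> k\<close>. Write \<open>\<delta>\<close> for the minimum degree.
  
  If \<open>m > k\<close>, the argument of Andrasfai, Erdos and Sos applies: two neighbours on the cycle of one
  vertex are at distance two along the cycle, since otherwise there is a shorter odd closed walk.
  So every vertex has at most two neighbours on the cycle, and double counting gives
  \<open>N * \<delta> \<le> 2 * n\<close>. Under the degree bound of the first part this forces equality everywhere, and then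
  the position of the two neighbours sorts the vertices into the parts of a balanced blow-up
  (\<open>blow_up_extremal\<close>). The degree bound of the second part excludes this case.
  
  If \<open>m < k\<close>, call two vertices close if they have at least \<open>10 * k\<^sup>2\<close> common neighbours. Since the
  degrees are linear in \<open>n\<close>, any \<open>4 * k + 1\<close> vertices contain a close pair. Hence the common
  neighbourhood of a close pair \<open>x\<close>, \<open>z\<close> contains a path of prescribed length in the closeness graph,
  which expands to paths from \<open>x\<close> to \<open>z\<close> of every even length up to \<open>2 * k\<close>, avoiding few given
  vertices. Together with a short odd path from \<open>x\<close> to \<open>z\<close> this would be a cycle of length
  \<open>2 * k + 1\<close>; so no odd path with at most \<open>2 * k\<close> vertices joins close vertices
  (\<open>not_close_of_odd_path\<close>).
  
  Choose for each cycle vertex \<open>v i\<close> a private neighbour \<open>u i\<close> off the cycle. Any two of these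
  \<open>2 * N\<close> anchors are joined by a short odd path, because the two arcs between two cycle vertices
  have different parities. So the anchors are pairwise not close, their neighbourhoods are almost
  disjoint, and \<open>2 * N * \<delta>\<close> exceeds \<open>n\<close> by a lower order term at most. This contradicts the degree
  bound of the first part, and in the second part it leaves only \<open>m = l\<close>.
  
  There, the anchors cannot be extended by one more vertex, so every vertex is an anchor or close to
  an anchor, and to just one since \<open>k\<close> is considerably larger than \<open>l\<close>. This splits the vertices
  into \<open>2 * N\<close> sides. An edge between two sides other than those of \<open>v i\<close> and \<open>u i\<close> would close a
  short odd path between close vertices unless it is an edge of the cycle. All neighbours of most
  vertices therefore lie in a single side, all sides have at least \<open>\<delta>\<close> vertices, and since
  \<open>n \<le> 2 * N * \<delta>\<close> all of them have exactly \<open>\<delta>\<close> vertices and opposite sides are completely joined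
  (\<open>BC_extremal\<close>).
\<close>

section \<open>Paths and cycles as lists\<close>

definition is_path :: "('a \<times> 'a) set \<Rightarrow> 'a \<Rightarrow> 'a list \<Rightarrow> 'a \<Rightarrow> bool" where
  "is_path E x p y \<longleftrightarrow> p \<noteq> [] \<and> hd p = x \<and> last p = y \<and> distinct p
     \<and> successively (\<lambda>a b. (a, b) \<in> E) p"

definition is_cycle :: "('a \<times> 'a) set \<Rightarrow> 'a list \<Rightarrow> bool" where
  "is_cycle E p \<longleftrightarrow> 3 \<le> length p \<and> distinct p
     \<and> successively (\<lambda>a b. (a, b) \<in> E) p \<and> (last p, hd p) \<in> E"

lemma is_path_single: "is_path E x [x] x"
  by (simp add: is_path_def)

lemma is_path_join:
  assumes "is_path E x p y" "is_path E y' q z" "(y, y') \<in> E" "set p \<inter> set q = {}"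
  shows "is_path E x (p @ q) z"
  using assms by (auto simp: is_path_def successively_append_iff)

lemma is_path_snoc:
  assumes "is_path E x p y" "(y, z) \<in> E" "z \<notin> set p"
  shows "is_path E x (p @ [z]) z"
  using is_path_join[OF assms(1) is_path_single assms(2)] assms(3) by simp

lemma is_path_Cons:
  assumes "is_path E y p z" "(x, y) \<in> E" "x \<notin> set p"
  shows "is_path E x (x # p) z"
  using is_path_join[OF is_path_single assms(1) assms(2)] assms(3) by simp

lemma is_path_rev:
  assumes "is_path E x p y" "sym E"
  shows "is_path E y (rev p) x"
  using assms by (auto simp: is_path_def hd_rev last_rev elim!: successively_mono dest: symD)

lemma is_path_join_cycle:
  assumes "is_path E x p y" "is_path E y' q z" "(y, y') \<in> E" "(z, x) \<in> E"
    and "set p \<inter> set q = {}" "3 \<le> length p + length q"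
  shows "is_cycle E (p @ q)"
  using is_path_join[OF assms(1,2,3,5)] assms(4,6) by (auto simp: is_path_def is_cycle_def)

section \<open>Isomorphisms and cycles in pair graphs\<close>

text \<open>
  The arc map of an isomorphism between pair graphs is determined by the vertex map, so a bijection of
  the vertices that preserves and reflects adjacency suffices.
\<close>
lemma isomorphicI:
  assumes "parcs G \<subseteq> pverts G \<times> pverts G" "parcs H \<subseteq> pverts H \<times> pverts H"
    and bij: "bij_betw f (pverts G) (pverts H)"
    and arcs: "\<And>x y. x \<in> pverts G \<Longrightarrow> y \<in> pverts G \<Longrightarrow>
      (x, y) \<in> parcs G \<longleftrightarrow> (f x, f y) \<in> parcs H"
  shows "isomorphic G H"
proof -
  let ?h = "\<lparr>iso_verts = f, iso_arcs = map_prod f f, iso_head = snd, iso_tail = fst\<rparr>"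
  have wf: "wf_digraph (with_proj G)"
    using assms(1) by unfold_locales auto
  have inj: "inj_on f (pverts G)" and im: "f ` pverts G = pverts H"
    using bij by (auto simp: bij_betw_def)
  have "inj_on (map_prod f f) (parcs G)"
    using map_prod_inj_on[OF inj inj] assms(1) by (rule inj_on_subset)
  then have iso: "pre_digraph.digraph_isomorphism (with_proj G) ?h"
    using wf inj by (auto simp: pre_digraph.digraph_isomorphism_def)
  have "parcs H \<subseteq> map_prod f f ` parcs G"
  proof
    fix e assume e: "e \<in> parcs H"
    obtain a b where ab: "e = (a, b)" by (cases e)
    from e ab assms(2) im have "a \<in> f ` pverts G" "b \<in> f ` pverts G" by auto
    then obtain x y where "x \<in> pverts G" "y \<in> pverts G" "a = f x" "b = f y" by auto
    with e ab arcs[of x y] show "e \<in> map_prod f f ` parcs G"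
      by (auto intro!: image_eqI[of _ _ "(x, y)"])
  qed
  moreover have "map_prod f f ` parcs G \<subseteq> parcs H"
    using assms(1) arcs by fastforce
  ultimately have "map_prod f f ` parcs G = parcs H" by blast
  then have "with_proj H = app_iso ?h (with_proj G)"
    by (simp add: app_iso_def with_proj_def im)
  with iso show ?thesis
    unfolding isomorphic_def digraph_iso_def by blast
qed

lemma contains_cycleI:
  assumes G: "parcs G \<subseteq> pverts G \<times> pverts G" "sym (parcs G)" and c: "is_cycle (parcs G) p"
  shows "contains_graph G (cycle_graph (length p))"
proof -
  let ?m = "length p"
  have m: "3 \<le> ?m" "distinct p" and last: "(last p, hd p) \<in> parcs G"
    and suc: "\<And>i. Suc i < ?m \<Longrightarrow> (p ! i, p ! Suc i) \<in> parcs G"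
    using c by (auto simp: is_cycle_def successively_conv_nth)
  have "p \<noteq> []" using m by auto
  have step: "(p ! i, p ! ((i + 1) mod ?m)) \<in> parcs G" if "i < ?m" for i
  proof (cases "Suc i < ?m")
    case True then show ?thesis using suc by simp
  next
    case False
    with that have "Suc i = ?m" by simp
    then show ?thesis using last \<open>p \<noteq> []\<close> by (simp add: last_conv_nth hd_conv_nth flip: \<open>Suc i = _\<close>)
  qed
  define H where "H = \<lparr>pverts = set p,
    parcs = (\<lambda>(i, j). (p ! i, p ! j)) ` parcs (cycle_graph ?m)\<rparr>"
  have HG: "parcs H \<subseteq> parcs G"
    using step G(2) by (auto simp: H_def cycle_graph_def dest: symD)
  have H: "parcs H \<subseteq> pverts H \<times> pverts H"
    by (auto simp: H_def cycle_graph_def)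
  have "set p \<subseteq> pverts G"
  proof
    fix x assume "x \<in> set p"
    then obtain i where "i < ?m" "x = p ! i" by (auto simp: in_set_conv_nth)
    with step[of i] G(1) show "x \<in> pverts G" by auto
  qed
  then have sub: "subgraph (with_proj H) (with_proj G)"
    using HG H G(1)
    by (auto simp: subgraph_def compatible_def intro!: wf_digraph.intro) (auto simp: H_def)
  have bij: "bij_betw ((!) p) {..<?m} (set p)"
    using m(2) by (simp add: bij_betw_nth)
  let ?g = "the_inv_into {..<?m} ((!) p)"
  have "isomorphic H (cycle_graph ?m)"
  proof (rule isomorphicI[of _ _ ?g])
    show "bij_betw ?g (pverts H) (pverts (cycle_graph ?m))"
      using bij_betw_the_inv_into[OF bij] by (simp add: H_def cycle_graph_def)
  next
    fix x y assume "x \<in> pverts H" "y \<in> pverts H"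
    then obtain i j where ij: "i < ?m" "j < ?m" "x = p ! i" "y = p ! j"
      by (auto simp: H_def in_set_conv_nth)
    then have g: "?g x = i" "?g y = j"
      using bij by (auto simp: bij_betw_def the_inv_into_f_f)
    have "(x, y) \<in> parcs H \<longleftrightarrow> (i, j) \<in> parcs (cycle_graph ?m)"
    proof
      assume "(x, y) \<in> parcs H"
      then obtain i' j' where "(i', j') \<in> parcs (cycle_graph ?m)" "x = p ! i'" "y = p ! j'"
        by (auto simp: H_def)
      moreover then have "i' < ?m" "j' < ?m" by (auto simp: cycle_graph_def)
      ultimately show "(i, j) \<in> parcs (cycle_graph ?m)"
        using ij m(2) nth_eq_iff_index_eq by metis
    qed (use ij in \<open>auto simp: H_def\<close>)
    then show "(x, y) \<in> parcs H \<longleftrightarrow> (?g x, ?g y) \<in> parcs (cycle_graph ?m)"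
      using g by simp
  qed (use H in \<open>auto simp: cycle_graph_def\<close>)
  with sub show ?thesis by (auto simp: contains_graph_def)
qed

section \<open>Odd closed walks\<close>

locale sgraph =
  fixes V :: "'a set" and E :: "('a \<times> 'a) set"
  assumes finite_V: "finite V" and E_sub: "E \<subseteq> V \<times> V"
    and sym_E: "sym E" and irrefl_E: "irrefl E"
begin

lemma edge_sym: "(x, y) \<in> E \<longleftrightarrow> (y, x) \<in> E"
  using sym_E by (auto dest: symD)

lemma no_loop: "(x, x) \<notin> E"
  using irrefl_E by (auto simp: irrefl_def)

lemma nbrs_sub: "E `` {x} \<subseteq> V"
  using E_sub by auto

lemma finite_nbrs: "finite (E `` {x})"
  using nbrs_sub finite_V by (rule finite_subset)

lemma walk_sym: "(x, y) \<in> E ^^ j \<Longrightarrow> (y, x) \<in> E ^^ j"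
proof (induction j arbitrary: y)
  case (Suc j)
  then obtain z where z: "(x, z) \<in> E ^^ j" "(z, y) \<in> E" by auto
  with Suc.IH have "(y, z) \<in> E" "(z, x) \<in> E ^^ j" using edge_sym by auto
  then show ?case by (rule relpow_Suc_I2)
qed simp

lemma walk_trans: "(x, y) \<in> E ^^ i \<Longrightarrow> (y, z) \<in> E ^^ j \<Longrightarrow> (x, z) \<in> E ^^ (i + j)"
  by (auto simp: relpow_add)

text \<open>
  If no closed walk is odd, the parity of the walks from a fixed representative of each connected
  component is a proper 2-colouring.
\<close>
lemma two_colouring_or_odd_closed_walk:
  assumes "\<not> (\<exists>A B. A \<union> B = V \<and> A \<inter> B = {} \<and> E \<subseteq> A \<times> B \<union> B \<times> A)"
  shows "\<exists>j x. odd j \<and> (x, x) \<in> E ^^ j"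
proof (rule ccontr)
  assume no: "\<not> ?thesis"
  define r where "r x = (SOME z. \<exists>j. (z, x) \<in> E ^^ j)" for x
  have r: "\<exists>j. (r x, x) \<in> E ^^ j" for x
    unfolding r_def by (rule someI_ex) (auto intro!: exI[of _ x] exI[of _ 0])
  have r_eq: "r x = r y" if "(x, y) \<in> E" for x y
  proof -
    have "(\<exists>j. (z, x) \<in> E ^^ j) = (\<exists>j. (z, y) \<in> E ^^ j)" for z
      using that edge_sym by (meson relpow_Suc_I)
    then show ?thesis by (simp add: r_def)
  qed
  define A where "A = {x \<in> V. \<exists>j. even j \<and> (r x, x) \<in> E ^^ j}"
  have "(x, y) \<in> A \<times> (V - A) \<union> (V - A) \<times> A" if e: "(x, y) \<in> E" for x y
  proof -
    have xy: "x \<in> V" "y \<in> V" using e E_sub by auto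
    obtain i j where i: "(r x, x) \<in> E ^^ i" and j: "(r x, y) \<in> E ^^ j"
      using r[of x] r[of y] r_eq[OF e] by auto
    have A_iff: "even a" if "z \<in> A" "(r z, z) \<in> E ^^ a" for z a
    proof (rule ccontr)
      assume "odd a"
      obtain b where "even b" "(r z, z) \<in> E ^^ b" using \<open>z \<in> A\<close> by (auto simp: A_def)
      with walk_trans[OF that(2) walk_sym] have "odd (a + b)" "(r z, r z) \<in> E ^^ (a + b)"
        using \<open>odd a\<close> by auto
      with no show False by blast
    qed
    have "(r x, r x) \<in> E ^^ (Suc i + j)"
      using walk_trans[OF relpow_Suc_I[OF i e] walk_sym[OF j]] .
    then have "even (Suc i + j)" using no by blast
    then have "even i \<noteq> even j" by auto
    then show ?thesis using A_iff[of x i] A_iff[of y j] i j xy r_eq[OF e]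
      by (auto simp: A_def)
  qed
  then have "E \<subseteq> A \<times> (V - A) \<union> (V - A) \<times> A" by auto
  moreover have "A \<union> (V - A) = V" "A \<inter> (V - A) = {}" by (auto simp: A_def)
  ultimately show False using assms by blast
qed

end

text \<open>
  The indices of a shortest odd closed walk run over all natural numbers with period \<open>N\<close>, so that
  both arcs between two of its vertices are intervals of indices. Minimality is stated for closed
  walks instead of cycles: shortcuts then never require a check of distinctness.
\<close>
locale odd_girth_cycle = sgraph +
  fixes v :: "nat \<Rightarrow> 'a" and N :: nat
  assumes odd_N: "odd N"
    and v_periodic: "v (i + N) = v i"
    and v_edge: "(v i, v (Suc i)) \<in> E"
    and girth: "odd j \<Longrightarrow> (x, x) \<in> E ^^ j \<Longrightarrow> N \<le> j"

context sgraph begin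

lemma obtain_odd_girth_cycle:
  assumes "odd j" "(x, x) \<in> E ^^ j"
  obtains v N where "odd_girth_cycle V E v N"
proof -
  define P where "P j \<longleftrightarrow> odd j \<and> (\<exists>x. (x, x) \<in> E ^^ j)" for j
  define N where "N = (LEAST j. P j)"
  have "P N" unfolding N_def by (rule LeastI[of _ j]) (use assms in \<open>auto simp: P_def\<close>)
  then obtain z where z: "odd N" "(z, z) \<in> E ^^ N" by (auto simp: P_def)
  then obtain f where f: "f 0 = z" "f N = z" "\<And>i. i < N \<Longrightarrow> (f i, f (Suc i)) \<in> E"
    by (auto simp: relpow_fun_conv)
  have N0: "N > 0" using z(1) by (cases N) auto
  have "odd_girth_cycle V E (\<lambda>i. f (i mod N)) N"
  proof
    fix i
    have "(f (i mod N), f (Suc (i mod N))) \<in> E" using f(3) N0 by simp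
    then show "(f (i mod N), f (Suc i mod N)) \<in> E"
      using f(1,2) by (cases "Suc (i mod N) = N") (auto simp: mod_Suc)
  next
    fix j x assume "odd j" "(x, x) \<in> E ^^ j"
    then show "N \<le> j" unfolding N_def by (intro Least_le) (auto simp: P_def)
  qed (use z in auto)
  then show ?thesis using that by blast
qed

end

context odd_girth_cycle begin

lemma N_pos: "N > 0"
  using odd_N by (cases N) auto

lemma v_add_mult: "v (i + a * N) = v i"
proof (induction a)
  case (Suc a)
  have "v (i + Suc a * N) = v ((i + a * N) + N)" by (simp add: algebra_simps)
  then show ?case using v_periodic Suc by simp
qed simp

lemma v_mod: "v (i mod N) = v i"
  using v_add_mult[of "i mod N" "i div N"] by simp

lemma v_in_V: "v i \<in> V"
  using v_edge[of i] E_sub by auto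

lemma v_walk: "(v i, v (i + d)) \<in> E ^^ d"
  by (induction d) (auto intro: v_edge)

lemma N_ge_3: "3 \<le> N"
proof (rule ccontr)
  assume "\<not> 3 \<le> N"
  with odd_N have "N = 1" by (auto elim!: oddE)
  then show False using v_edge[of 0] v_periodic[of 0] no_loop by simp
qed

text \<open>
  A walk of length \<open>a\<close> between two vertices of the cycle closes up with either of the two arcs. The
  arcs have lengths \<open>j - i\<close> and \<open>N - (j - i)\<close> of different parities, so exactly one of the two closed
  walks is odd, and that one has length at least \<open>N\<close>.
\<close>
lemma shortcut:
  assumes "i < j" "j < i + N" "(v j, v i) \<in> E ^^ a"
  shows "if odd (j - i + a) then N \<le> j - i + a else j - i \<le> a"
proof (cases "odd (j - i + a)")
  case True
  have "(v i, v i) \<in> E ^^ (j - i + a)"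
    using walk_trans[OF v_walk[of i "j - i"], of "v i" a] assms by simp
  with True girth show ?thesis by simp
next
  case False
  have "(v j, v i) \<in> E ^^ (i + N - j)"
    using v_walk[of j "i + N - j"] assms v_periodic by simp
  from walk_trans[OF this walk_sym[OF assms(3)]]
  have "(v j, v j) \<in> E ^^ (i + N - j + a)" .
  moreover have "odd (i + N - j + a)"
  proof -
    have "(i + N - j + a) + (j - i + a) = N + 2 * a" using assms by simp
    then have "odd ((i + N - j + a) + (j - i + a))" using odd_N by simp
    then show ?thesis using False by simp
  qed
  ultimately have "N \<le> i + N - j + a" using girth by blast
  then show ?thesis using False assms by simp
qed

lemma v_inj: "i < j \<Longrightarrow> j < i + N \<Longrightarrow> v i \<noteq> v j"
  using shortcut[of i j 0] by (auto split: if_splits)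

lemma v_inj_on: "inj_on v {i..<i + N}"
proof (rule linorder_inj_onI)
  fix a b assume "a < b" "a \<in> {i..<i + N}" "b \<in> {i..<i + N}"
  then show "v a \<noteq> v b" using v_inj[of a b] by auto
qed auto

lemma v_inj_on0: "inj_on v {..<N}"
  using v_inj_on[of 0] by (simp add: lessThan_atLeast0)

lemma chord:
  assumes "i < j" "j < N" "(v i, v j) \<in> E"
  shows "j = i + 1 \<or> j + 1 = i + N"
  using shortcut[of i j 1] assms edge_sym by (auto split: if_splits)

lemma common_neighbour:
  assumes "i < j" "j < N" "(w, v i) \<in> E" "(w, v j) \<in> E"
  shows "j = i + 2 \<or> j + 2 = i + N"
proof -
  have "(v j, v i) \<in> E ^^ 2"
    using assms edge_sym by (auto simp: numeral_2_eq_2)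
  from shortcut[OF assms(1) _ this] assms(1,2) show ?thesis
    using odd_N by (auto split: if_splits elim!: oddE evenE)
qed

lemma v_path: "i < j \<Longrightarrow> j < i + N \<Longrightarrow> is_path E (v i) (map v [i..<Suc j]) (v j)"
  unfolding is_path_def
  by (auto simp: hd_map last_map distinct_map successively_map successively_conv_nth v_edge 
      simp del: upt_Suc intro!: inj_on_subset[OF v_inj_on[of i]])

lemma v_cycle: "is_cycle E (map v [0..<N])"
proof -
  have "(v (N - 1), v 0) \<in> E" using v_edge[of "N - 1"] v_periodic[of 0] N_pos by simp
  then show ?thesis using N_ge_3 v_inj_on[of 0]
  unfolding is_cycle_def
  by (auto simp: hd_map last_map distinct_map successively_map successively_conv_nth v_edge)
qed

text \<open>
  The two arcs between distinct vertices of an odd cycle provide a path of either parity.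
\<close>
lemma arc:
  assumes "i < N" "j < N" "i \<noteq> j"
  obtains p where "is_path E (v i) p (v j)" "set p \<subseteq> v ` {..<N}" "length p \<le> N"
    "even (length p) = b"
proof -
  have *: "\<exists>p. is_path E (v i) p (v j) \<and> set p \<subseteq> v ` {..<N} \<and> length p \<le> N \<and> even (length p) = b"
    if "i < j" "j < N" for i j
  proof -
    have rng: "v a \<in> v ` {..<N}" for a using v_mod[of a] N_pos by (metis imageI lessThan_iff mod_less_divisor)
    have p: "is_path E (v i) (map v [i..<Suc j]) (v j)" using v_path that by simp
    have "is_path E (v j) (map v [j..<Suc (i + N)]) (v (i + N))" using v_path that by simp
    then have q: "is_path E (v i) (rev (map v [j..<Suc (i + N)])) (v j)"
      using is_path_rev[OF _ sym_E] v_periodic by fastforce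
    have "length (map v [i..<Suc j]) + length (map v [j..<Suc (i + N)]) = N + 2"
      using that by simp
    then have "even (length (map v [i..<Suc j])) \<noteq> even (length (map v [j..<Suc (i + N)]))"
      using odd_N by (metis even_add even_numeral)
    then consider "even (length (map v [i..<Suc j])) = b" | "even (length (map v [j..<Suc (i + N)])) = b"
      by blast
    then show ?thesis
    proof cases
      case 1
      then show ?thesis using p that rng by (intro exI[of _ "map v [i..<Suc j]"]) (auto simp del: upt_Suc)
    next
      case 2
      then show ?thesis using q that rng
        by (intro exI[of _ "rev (map v [j..<Suc (i + N)])"]) (auto simp del: upt_Suc)
    qed
  qed
  show ?thesis
  proof (cases "i < j")
    case True
    then show ?thesis using *[of i j] assms that by blast
  next
    case False
    then obtain p where "is_path E (v j) p (v i)" "set p \<subseteq> v ` {..<N}" "length p \<le> N" "even (length p) = b"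
      using *[of j i] assms by auto
    then show ?thesis using that[of "rev p"] is_path_rev[OF _ sym_E] by auto
  qed
qed

end

section \<open>Few neighbours on a shortest odd cycle: the blow-up\<close>

context odd_girth_cycle begin

definition hits :: "'a \<Rightarrow> nat set" where
  "hits w = {i. i < N \<and> (w, v i) \<in> E}"

lemma finite_hits: "finite (hits w)"
  by (simp add: hits_def)

text \<open>
  Three neighbours would be pairwise at cyclic distance two, which is possible only in a cycle of
  length three or six.
\<close>
lemma card_hits_le_2:
  assumes "5 \<le> N"
  shows "card (hits w) \<le> 2"
proof (rule ccontr)
  assume "\<not> ?thesis"
  then have "3 \<le> card (hits w)" by simp
  then obtain T where T: "T \<subseteq> hits w" "card T = 3" by (meson obtain_subset_with_card_n)
  then have fT: "finite T" by (metis card.infinite zero_neq_numeral)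
  obtain xs where xs: "sorted xs" "set xs = T" "length xs = 3" "distinct xs"
    using sorted_list_of_set[of T] fT T(2) length_sorted_list_of_set[of T] by metis
  then obtain a b c where "xs = [a, b, c]" 
    by (auto simp: numeral_3_eq_3 length_Suc_conv)
  then have "a < b" "b < c" "a \<in> hits w" "b \<in> hits w" "c \<in> hits w" using xs T by auto
  then show False
    using common_neighbour[of a b w] common_neighbour[of b c w] common_neighbour[of a c w] assms odd_N
    by (auto simp: hits_def; presburger)
qed

lemma sum_degree_eq: "(\<Sum>i<N. card (E `` {v i})) = (\<Sum>w\<in>V. card (hits w))"
proof -
  have "card (E `` {v i}) = (\<Sum>w\<in>V. if (w, v i) \<in> E then 1 else 0)" for i
  proof -
    have "E `` {v i} = {w \<in> V. (w, v i) \<in> E}" using edge_sym E_sub by auto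
    then show ?thesis using finite_V by (simp add: sum.If_cases Int_def)
  qed
  moreover have "card (hits w) = (\<Sum>i<N. if (w, v i) \<in> E then 1 else 0)" for w
    by (simp add: sum.If_cases Int_def hits_def)
  ultimately show ?thesis by (simp add: sum.swap[of _ V])
qed

lemma min_degree_bound:
  assumes "5 \<le> N" "\<And>x. x \<in> V \<Longrightarrow> \<delta> \<le> card (E `` {x})"
  shows "N * \<delta> \<le> 2 * card V"
proof -
  have "N * \<delta> \<le> (\<Sum>i<N. card (E `` {v i}))"
    using sum_mono[of "{..<N}" "\<lambda>_. \<delta>" "\<lambda>i. card (E `` {v i})"] assms(2) v_in_V by simp
  also have "\<dots> \<le> 2 * card V"
    unfolding sum_degree_eq using sum_mono[of V "\<lambda>w. card (hits w)" "\<lambda>_. 2"] card_hits_le_2[OF assms(1)]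
    by simp
  finally show ?thesis .
qed

lemma extremal_degrees:
  assumes "5 \<le> N" "\<And>x. x \<in> V \<Longrightarrow> \<delta> \<le> card (E `` {x})" "N * \<delta> = 2 * card V"
  shows "w \<in> V \<Longrightarrow> card (hits w) = 2" "card (E `` {v i}) = \<delta>"
proof -
  have le: "(\<Sum>i<N. card (E `` {v i})) \<ge> (\<Sum>i<N. \<delta>)"
    using assms(2) v_in_V by (intro sum_mono) simp
  have ge: "(\<Sum>w\<in>V. card (hits w)) \<le> (\<Sum>w\<in>V. 2)"
    using card_hits_le_2[OF assms(1)] by (intro sum_mono)
  have eq1: "(\<Sum>i<N. \<delta>) = (\<Sum>i<N. card (E `` {v i}))"
    and eq2: "(\<Sum>w\<in>V. card (hits w)) = (\<Sum>w\<in>V. 2)"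
    using le ge assms(3) sum_degree_eq by simp_all
  show "card (hits w) = 2" if "w \<in> V"
    using sum_mono_inv[OF eq2 _ that finite_V] card_hits_le_2[OF assms(1)] by simp
  have "\<delta> = card (E `` {v (i mod N)})"
    using sum_mono_inv[OF eq1, of "i mod N"] assms(2) v_in_V N_pos by simp
  then show "card (E `` {v i}) = \<delta>" using v_mod by simp
qed

text \<open>
  The vertex \<open>v c\<close> is the one between the two neighbours; adding \<open>N\<close> avoids a truncated subtraction
  at \<open>c = 0\<close>.
\<close>
lemma two_neighbours:
  assumes "5 \<le> N" "card (hits w) = 2"
  obtains c where "c < N" "hits w = {(c + 1) mod N, (c + N - 1) mod N}"
proof -
  obtain a b where ab: "hits w = {a, b}" "a < b"
    using assms(2) by (metis card_2_iff insert_commute linorder_neqE_nat)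
  then have "a < N" "b < N" "(w, v a) \<in> E" "(w, v b) \<in> E" by (auto simp: hits_def)
  then have "b = a + 2 \<or> b + 2 = a + N" using common_neighbour ab by blast
  then consider "b = a + 2" | "a = 0" "b = N - 2" | "a = 1" "b = N - 1"
    using \<open>b < N\<close> by linarith
  then show ?thesis
  proof cases
    case 1
    then have "(a + 1 + 1) mod N = b" "(a + 1 + N - 1) mod N = a" using \<open>b < N\<close> by auto
    then show ?thesis using that[of "a + 1"] ab 1 \<open>b < N\<close> by auto
  next
    case 2
    have "(N - 1 + 1) mod N = 0" using assms by simp
    moreover have "(N - 1 + N - 1) mod N = N - 2"
    proof -
      have "N - 1 + N - 1 = N - 2 + N" using assms by simp
      then have "(N - 1 + N - 1) mod N = (N - 2) mod N" by (metis mod_add_self2)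
      then show ?thesis using assms by simp
    qed
    ultimately show ?thesis using that[of "N - 1"] ab 2 assms by auto
  next
    case 3
    then show ?thesis using that[of 0] ab assms by auto
  qed
qed

text \<open>
  A vertex whose neighbours on the cycle are those of \<open>v c\<close> can replace \<open>v c\<close>, which gives another
  shortest odd cycle. Everything known about neighbours on the cycle applies to the new one as well.
\<close>
lemma substitute:
  assumes "(w, v ((c + 1) mod N)) \<in> E" "(w, v ((c + N - 1) mod N)) \<in> E" "c < N"
  shows "odd_girth_cycle V E (\<lambda>i. if i mod N = c then w else v i) N"
proof
  have nb: "(w, v (c + 1)) \<in> E" "(w, v (c + N - 1)) \<in> E" using assms v_mod by metis+
  fix i
  have "(v i, w) \<in> E" if "Suc i mod N = c"
  proof -
    have "i mod N = (c + N - 1) mod N"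
    proof (cases "c = 0")
      case True
      with that N_pos show ?thesis by (auto simp: mod_Suc split: if_splits)
    next
      case False
      with that assms(3) show ?thesis by (auto simp: mod_Suc split: if_splits)
    qed
    then have "v i = v (c + N - 1)" using v_mod by metis
    with nb edge_sym show ?thesis by simp
  qed
  moreover have "(w, v (Suc i)) \<in> E" if "i mod N = c"
  proof -
    have "Suc i mod N = (c + 1) mod N" using that by (metis Suc_eq_plus1 mod_Suc_eq)
    then have "v (Suc i) = v (c + 1)" using v_mod by metis
    with nb show ?thesis by simp
  qed
  moreover have "Suc i mod N \<noteq> i mod N" using N_ge_3 by (auto simp: mod_Suc)
  ultimately show "((if i mod N = c then w else v i), (if Suc i mod N = c then w else v (Suc i))) \<in> E"
    using v_edge by auto
qed (use odd_N v_periodic girth in auto)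

text \<open>
  If \<open>w'\<close> did not look like a vertex next to \<open>v c\<close>, it would keep both of its neighbours on the cycle
  when \<open>w\<close> is substituted for \<open>v c\<close>, and would gain \<open>w\<close> as a third one.
\<close>
lemma edge_between_classes:
  assumes "5 \<le> N" "c < N" "d < N" "hits w = {(c + 1) mod N, (c + N - 1) mod N}"
    "hits w' = {(d + 1) mod N, (d + N - 1) mod N}" "(w, w') \<in> E"
    and "card (hits w') = 2"
  shows "d = (c + 1) mod N \<or> c = (d + 1) mod N"
proof (rule ccontr)
  assume not: "\<not> ?thesis"
  have w: "(w, v ((c + 1) mod N)) \<in> E" "(w, v ((c + N - 1) mod N)) \<in> E"
    using assms(4) by (auto simp: hits_def)
  interpret S: odd_girth_cycle V E "\<lambda>i. if i mod N = c then w else v i" N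
    using substitute[OF w assms(2)] .
  have "c \<notin> hits w'"
  proof
    assume "c \<in> hits w'"
    with assms(5) not have c: "c = (d + N - 1) mod N" by auto
    have "(c + 1) mod N = (d + N - 1 + 1) mod N" unfolding c by (simp add: mod_Suc_eq)
    also have "\<dots> = d" using assms(1,3) by simp
    finally show False using not by simp
  qed
  then have "insert c (hits w') \<subseteq> S.hits w'"
    using assms(2,6) edge_sym by (auto simp: hits_def S.hits_def)
  then have "card (insert c (hits w')) \<le> 2"
    using S.card_hits_le_2[OF assms(1), of w'] card_mono[OF S.finite_hits] order.trans by blast
  then show False using \<open>c \<notin> hits w'\<close> assms(7) finite_hits by simp
qed

text \<open>
  Such a sequence has period four, and an odd period \<open>N\<close>. Some multiple of four is congruent to two
  modulo \<open>N\<close>, so it has period two.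
\<close>
lemma periodic_sum_constant:
  fixes S :: "nat \<Rightarrow> nat"
  assumes per: "\<And>i. S (i + N) = S i" and sum: "\<And>i. S i + S (i + 2) = \<delta>"
  shows "2 * S i = \<delta>"
proof -
  have per2: "S (i + a * N) = S i" for i a
  proof (induction a)
    case (Suc a)
    have "S (i + Suc a * N) = S ((i + a * N) + N)" by (simp add: algebra_simps)
    then show ?case using per Suc by simp
  qed simp
  have s4: "S (i + 4 * a) = S i" for i a
  proof (induction a)
    case (Suc a)
    have "S (i + 4 * Suc a) = S ((i + 4 * a) + 2 + 2)" by (rule arg_cong[where f = S]) simp
    also have "\<dots> = S (i + 4 * a)" using sum[of "i + 4 * a"] sum[of "i + 4 * a + 2"] by simp
    finally show ?case using Suc by simp
  qed simp
  obtain a b where ab: "4 * a = b * N + 2"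
  proof -
    obtain q where q: "N = 2 * q + 1" using odd_N by (auto elim: oddE)
    have "4 * (q + 1) = 2 * N + 2" using q by simp
    then show ?thesis using that by blast
  qed
  have "S (i + 2) = S (i + 2 + b * N)" using per2[of "i + 2" b] by (rule sym)
  also have "\<dots> = S (i + 4 * a)" using ab by (intro arg_cong[where f = S]) simp
  also have "\<dots> = S i" using s4 .
  finally show ?thesis using sum[of i] by simp
qed

text \<open>
  Equality in the double count makes every vertex look like exactly one cycle vertex \<open>v i\<close>. The
  neighbourhood of \<open>v (Suc i)\<close> consists of the classes \<open>C i\<close> and \<open>C (i + 2)\<close>, so the sizes of these
  two always sum to \<open>\<delta>\<close>, and all classes are equally large. A vertex has neighbours only in the two
  neighbouring classes, whose union has \<open>\<delta>\<close> elements; hence it is joined to all of them.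
\<close>
lemma blow_up_extremal:
  assumes N5: "5 \<le> N" and deg: "\<And>x. x \<in> V \<Longrightarrow> \<delta> \<le> card (E `` {x})"
    and ext: "N * \<delta> = 2 * card V"
  shows "N dvd card V \<and>
    isomorphic \<lparr>pverts = V, parcs = E\<rparr> (blow_up (cycle_graph N) (card V div N))"
proof -
  note card2 = extremal_degrees(1)[OF N5 deg ext] and degv = extremal_degrees(2)[OF N5 deg ext]
  have "\<forall>w. \<exists>c. w \<in> V \<longrightarrow> c < N \<and> hits w = {(c + 1) mod N, (c + N - 1) mod N}"
    using two_neighbours[OF N5 card2] by metis
  then obtain cl where cl: "\<And>w. w \<in> V \<Longrightarrow> cl w < N"
    "\<And>w. w \<in> V \<Longrightarrow> hits w = {(cl w + 1) mod N, (cl w + N - 1) mod N}" by metis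
  define C where "C i = {w \<in> V. cl w = i mod N}" for i
  have finC: "finite (C i)" for i using finite_V by (simp add: C_def)
  have nb: "E `` {v (Suc i)} = C i \<union> C (i + 2)" for i
  proof -
    have "(w, v (Suc i)) \<in> E \<longleftrightarrow> Suc i mod N \<in> hits w" for w
      using N_pos v_mod by (simp add: hits_def)
    moreover have "Suc i mod N \<in> hits w \<longleftrightarrow> cl w = i mod N \<or> cl w = (i + 2) mod N" if "w \<in> V" for w
    proof -
      have "Suc i mod N = (cl w + 1) mod N \<longleftrightarrow> cl w = i mod N"
      proof
        assume "Suc i mod N = (cl w + 1) mod N"
        then show "cl w = i mod N" using cl(1)[OF that]
          by (auto simp: mod_Suc split: if_splits)
      qed (simp add: mod_Suc_eq)
      moreover have "Suc i mod N = (cl w + N - 1) mod N \<longleftrightarrow> cl w = (i + 2) mod N"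
      proof
        assume *: "Suc i mod N = (cl w + N - 1) mod N"
        have "(i + 2) mod N = (Suc i mod N + 1) mod N" by (simp add: mod_Suc_eq)
        also have "\<dots> = (cl w + N - 1 + 1) mod N" unfolding * by (simp add: mod_Suc_eq)
        also have "\<dots> = cl w" using cl(1)[OF that] by simp
        finally show "cl w = (i + 2) mod N" ..
      next
        assume *: "cl w = (i + 2) mod N"
        have "(cl w + N - 1) mod N = (cl w + (N - 1)) mod N" using N_pos by simp
        also have "\<dots> = (i + 2 + (N - 1)) mod N" unfolding * by (simp add: mod_add_left_eq)
        also have "i + 2 + (N - 1) = Suc i + N" using N_pos by simp
        also have "(Suc i + N) mod N = Suc i mod N" by (rule mod_add_self2)
        finally show "Suc i mod N = (cl w + N - 1) mod N" ..
      qed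
      ultimately show ?thesis using cl(2)[OF that] by auto
    qed
    ultimately show ?thesis using edge_sym E_sub by (auto simp: C_def)
  qed
  have disj: "C i \<inter> C (i + 2) = {}" for i
  proof -
    have "i mod N \<noteq> (i + 2) mod N"
    proof
      assume "i mod N = (i + 2) mod N"
      then have "N dvd (i + 2) - i" by (metis le_add1 mod_eq_dvd_iff_nat)
      then show False using N5 by (auto dest: dvd_imp_le)
    qed
    then show ?thesis by (auto simp: C_def)
  qed
  have "card (C i) + card (C (i + 2)) = \<delta>" for i
    using degv[of "Suc i"] nb[of i] card_Un_disjoint[OF finC finC disj] by simp
  then have size: "2 * card (C i) = \<delta>" for i
    by (intro periodic_sum_constant[of "\<lambda>i. card (C i)"]) (auto simp: C_def)
  define t where "t = card (C 0)"
  have t: "card (C i) = t" for i using size[of i] size[of 0] by (simp add: t_def)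
  have t2: "2 * t = \<delta>" using size[of 0] by (simp add: t_def)
  have nt: "card V = N * t" using ext t2 by auto
  have bijs: "\<exists>h. bij_betw h (C i) {..<t}" for i
    using ex_bij_betw_finite_nat[OF finC, of i] t by (simp add: atLeast0LessThan)
  then obtain h where h: "\<And>i. bij_betw (h i) (C i) {..<t}" by metis
  \<comment> \<open>The class becomes the vertex of the cycle, the number within the class the copy of that vertex.\<close>
  define f where "f w = (cl w, h (cl w) w)" for w
  have C_cl: "w \<in> V \<Longrightarrow> w \<in> C (cl w)" for w using cl(1) by (simp add: C_def)
  have bij: "bij_betw f V ({..<N} \<times> {..<t})"
  proof (rule bij_betw_imageI)
    show "inj_on f V"
    proof (rule inj_onI)
      fix x y assume "x \<in> V" "y \<in> V" "f x = f y"
      then show "x = y"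
        using C_cl[of x] C_cl[of y] bij_betw_imp_inj_on[OF h[of "cl x"]] by (auto simp: f_def dest: inj_onD)
    qed
    show "f ` V = {..<N} \<times> {..<t}"
    proof (intro equalityI subsetI)
      fix z assume "z \<in> f ` V"
      then show "z \<in> {..<N} \<times> {..<t}" using cl(1) C_cl bij_betwE[OF h] by (auto simp: f_def)
    next
      fix z assume "z \<in> {..<N} \<times> {..<t}"
      then obtain i j where ij: "z = (i, j)" "i < N" "j < t" by auto
      then have "j \<in> h i ` C i" using h[of i] by (auto simp: bij_betw_def)
      then show "z \<in> f ` V" using ij by (auto simp: f_def C_def)
    qed
  qed
  have C_wrap: "C (a + (N - 1) + 2) = C (a + 1)" for a
  proof -
    have "a + (N - 1) + 2 = a + 1 + N" using N_pos by simp
    then have "(a + (N - 1) + 2) mod N = (a + 1) mod N" by (metis mod_add_self2)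
    then show ?thesis by (simp only: C_def)
  qed
  have adj: "(w, w') \<in> E \<longleftrightarrow> cl w' = (cl w + 1) mod N \<or> cl w = (cl w' + 1) mod N"
    if "w \<in> V" "w' \<in> V" for w w'
  proof
    assume "(w, w') \<in> E"
    then show "cl w' = (cl w + 1) mod N \<or> cl w = (cl w' + 1) mod N"
      using edge_between_classes[OF N5 cl(1) cl(1) cl(2) cl(2) _ card2] that by blast
  next
    have nbrs_eq: "E `` {x} = C (cl x + (N - 1)) \<union> C (cl x + (N - 1) + 2)" if x: "x \<in> V" for x
    proof (rule card_subset_eq)
      show "E `` {x} \<subseteq> C (cl x + (N - 1)) \<union> C (cl x + (N - 1) + 2)"
      proof
        fix y assume "y \<in> E `` {x}"
        then have e: "(x, y) \<in> E" "y \<in> V" using E_sub by auto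
        then have "cl y = (cl x + 1) mod N \<or> cl x = (cl y + 1) mod N"
          using edge_between_classes[OF N5 cl(1) cl(1) cl(2) cl(2) _ card2] x by blast
        moreover have "C (cl x + (N - 1) + 2) = C (cl x + 1)" by (rule C_wrap)
        moreover have "cl y = (cl x + (N - 1)) mod N" if *: "cl x = (cl y + 1) mod N"
        proof -
          have "(cl x + (N - 1)) mod N = (cl y + 1 + (N - 1)) mod N" unfolding * 
            by (simp add: mod_add_left_eq)
          also have "cl y + 1 + (N - 1) = cl y + N" using N_pos by simp
          finally show ?thesis using cl(1)[OF e(2)] by simp
        qed
        ultimately have "y \<in> C (cl x + 1) \<or> y \<in> C (cl x + (N - 1))"
          using e(2) unfolding C_def by blast
        with C_wrap[of "cl x"] show "y \<in> C (cl x + (N - 1)) \<union> C (cl x + (N - 1) + 2)"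
          by blast
      qed
      then have "card (E `` {x}) \<le> card (C (cl x + (N - 1)) \<union> C (cl x + (N - 1) + 2))"
        using finC by (intro card_mono) auto
      moreover have "card (C (cl x + (N - 1)) \<union> C (cl x + (N - 1) + 2)) = \<delta>"
        using card_Un_disjoint[OF finC finC disj] t t2 by simp
      ultimately show "card (E `` {x}) = card (C (cl x + (N - 1)) \<union> C (cl x + (N - 1) + 2))"
        using deg[OF x] by simp
    qed (use finC in auto)
    have nx: "(x, y) \<in> E" if y: "x \<in> V" "y \<in> V" "cl y = (cl x + 1) mod N" for x y
    proof -
      have "y \<in> C (cl x + (N - 1) + 2)" unfolding C_wrap using y by (simp add: C_def)
      then show "(x, y) \<in> E" using nbrs_eq[OF y(1)] by blast
    qed
    assume "cl w' = (cl w + 1) mod N \<or> cl w = (cl w' + 1) mod N"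
    then show "(w, w') \<in> E" using nx[of w w'] nx[of w' w] that edge_sym by blast
  qed
  have t_eq: "card V div N = t" using nt N_pos by simp
  have "isomorphic \<lparr>pverts = V, parcs = E\<rparr> (blow_up (cycle_graph N) (card V div N))"
    unfolding t_eq
  proof (rule isomorphicI[of _ _ f])
    show "bij_betw f (pverts \<lparr>pverts = V, parcs = E\<rparr>) (pverts (blow_up (cycle_graph N) t))"
      using bij by (simp add: blow_up_def cycle_graph_def)
  next
    fix x y assume "x \<in> pverts \<lparr>pverts = V, parcs = E\<rparr>" "y \<in> pverts \<lparr>pverts = V, parcs = E\<rparr>"
    then have xy: "x \<in> V" "y \<in> V" by auto
    then have "f x \<in> {..<N} \<times> {..<t}" "f y \<in> {..<N} \<times> {..<t}" using bij by (auto simp: bij_betw_def)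
    then show "(x, y) \<in> parcs \<lparr>pverts = V, parcs = E\<rparr> \<longleftrightarrow> (f x, f y) \<in> parcs (blow_up (cycle_graph N) t)"
      using adj[OF xy] by (auto simp: blow_up_def cycle_graph_def f_def)
  qed (use E_sub in \<open>auto simp: blow_up_def cycle_graph_def\<close>)
  then show ?thesis using nt by simp
qed

end

section \<open>Paths of prescribed length through large common neighbourhoods\<close>

text \<open>
  An arbitrary injection \<open>g\<close> orders the vertices, and only increasing paths are built; this makes them
  automatically distinct. The vertices without a smaller neighbour form an independent set. Removing
  them costs at most \<open>s\<close> vertices, and an increasing path among the others can be extended downwards.
\<close>
lemma ordered_path_of_small_independent_sets:
  fixes g :: "'a \<Rightarrow> nat"
  assumes "finite B" "inj_on g B"
    and "\<And>I. I \<subseteq> B \<Longrightarrow> (\<And>x y. x \<in> I \<Longrightarrow> y \<in> I \<Longrightarrow> x \<noteq> y \<Longrightarrow> \<not> R x y) \<Longrightarrow> card I \<le> s"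
    and "\<And>x y. R x y \<Longrightarrow> R y x" and "s * r < card B"
  shows "\<exists>as. length as = Suc r \<and> set as \<subseteq> B \<and> sorted_wrt (\<lambda>x y. g x < g y) as \<and> successively R as"
  using assms
proof (induction r arbitrary: B)
  case 0
  then obtain x where "x \<in> B" by fastforce
  then show ?case by (intro exI[of _ "[x]"]) simp
next
  case (Suc r)
  \<comment> \<open>The vertices with a smaller neighbour are those from which a path can be extended downwards.\<close>
  define B' where "B' = {v \<in> B. \<exists>u\<in>B. g u < g v \<and> R u v}"
  have B'B: "B' \<subseteq> B" by (auto simp: B'_def)
  have "card (B - B') \<le> s"
  proof (rule Suc.prems(3))
    fix x y assume xy: "x \<in> B - B'" "y \<in> B - B'" "x \<noteq> y"
    then have "g x \<noteq> g y" using Suc.prems(2) by (auto dest: inj_onD)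
    then have "g x < g y \<or> g y < g x" by auto
    then show "\<not> R x y" using xy Suc.prems(4) by (auto simp: B'_def)
  qed auto
  moreover have "card (B - B') = card B - card B'"
    using B'B Suc.prems(1) by (simp add: card_Diff_subset finite_subset)
  ultimately have "s * r < card B'" using Suc.prems(5) by simp
  moreover have "card I \<le> s"
    if "I \<subseteq> B'" "\<And>x y. x \<in> I \<Longrightarrow> y \<in> I \<Longrightarrow> x \<noteq> y \<Longrightarrow> \<not> R x y" for I
    using that Suc.prems(3)[of I] B'B by blast
  ultimately obtain as where as: "length as = Suc r" "set as \<subseteq> B'"
    "sorted_wrt (\<lambda>x y. g x < g y) as" "successively R as"
    using Suc.IH[of B'] B'B Suc.prems(1,2,4) finite_subset inj_on_subset by metis
  then obtain a as' where a: "as = a # as'" by (cases as) auto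
  then obtain u where "u \<in> B" "g u < g a" "R u a" using as(2) by (auto simp: B'_def)
  then show ?case using as a B'B by (intro exI[of _ "u # as"]) auto
qed

context sgraph begin

definition close :: "nat \<Rightarrow> 'a \<Rightarrow> 'a \<Rightarrow> bool" where
  "close K x z \<longleftrightarrow> x \<noteq> z \<and> K \<le> card (E `` {x} \<inter> E `` {z})"

lemma close_sym: "close K x z \<Longrightarrow> close K z x"
  by (auto simp: close_def Int_commute)

lemma common_neighbour_avoiding:
  assumes "close K x z" "finite S" "card S < K"
  obtains c where "(x, c) \<in> E" "(c, z) \<in> E" "c \<notin> S"
proof -
  have "\<not> E `` {x} \<inter> E `` {z} \<subseteq> S"
    using assms(1,3) card_mono[OF assms(2)] unfolding close_def by (meson leD order.trans)
  then show ?thesis using that edge_sym by auto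
qed

text \<open>
  Consecutive members of the chain have so many common neighbours that unused ones can be inserted
  greedily between them.
\<close>
lemma path_through_close_chain:
  assumes "as \<noteq> []" "distinct as" "successively (close K) as" "finite S" "set as \<inter> S = {}"
    and "card S + 2 * length as \<le> K"
  shows "\<exists>p. is_path E (hd as) p (last as) \<and> length p = 2 * length as - 1 \<and> set p \<inter> S = {}"
  using assms
proof (induction as arbitrary: S rule: induct_list012)
  case (2 a)
  then show ?case by (intro exI[of _ "[a]"]) (simp add: is_path_single)
next
  case (3 a b as)
  have "card (insert a S) + 2 * length (b # as) \<le> K"
    using 3(8) card_insert_le_m1 by (simp add: card_insert_if 3(6))
  then obtain p where p: "is_path E b p (last (b # as))" "length p = 2 * length (b # as) - 1"
    "set p \<inter> insert a S = {}"
    using 3(2)[of "insert a S"] 3(4-7) by auto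
  have "card (insert a S \<union> set p) \<le> card (insert a S) + card (set p)"
    by (rule card_Un_le)
  also have "\<dots> \<le> Suc (card S) + length p"
    using 3(6) by (intro add_mono card_length) (simp add: card_insert_if)
  also have "\<dots> < K" using 3(8) p(2) by simp
  finally have "card (insert a S \<union> set p) < K" .
  moreover have "close K a b" using 3(5) by simp
  ultimately obtain c where c: "(a, c) \<in> E" "(c, b) \<in> E" "c \<notin> insert a S \<union> set p"
    using common_neighbour_avoiding[of K a b "insert a S \<union> set p"] 3(6) by auto
  have "is_path E c (c # p) (last (b # as))" using p(1) c by (intro is_path_Cons) auto
  then have "is_path E a (a # c # p) (last (b # as))" using c p(3) by (intro is_path_Cons) auto
  then show ?case using p c 3(7) by (intro exI[of _ "a # c # p"]) auto
qed simp

text \<open>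
  Neighbourhoods of vertices that are pairwise not close overlap in fewer than \<open>K\<close> vertices, so
  the sum of their sizes hardly exceeds that of their union.
\<close>
lemma pairwise_not_close_count:
  assumes "finite X" "\<And>x y. x \<in> X \<Longrightarrow> y \<in> X \<Longrightarrow> x \<noteq> y \<Longrightarrow> \<not> close K x y"
    and "\<And>x. x \<in> X \<Longrightarrow> \<delta> \<le> card (E `` {x})"
  shows "card X * \<delta> \<le> card V + (card X)\<^sup>2 * K"
proof -
  have "card X * \<delta> \<le> card (\<Union>x\<in>X. E `` {x}) + (card X)\<^sup>2 * K"
    using assms
  proof (induction X rule: finite_induct)
    case (insert x X)
    let ?U = "\<Union>y\<in>X. E `` {y}"
    have fU: "finite ?U" using insert(1) finite_nbrs by auto
    have IH: "card X * \<delta> \<le> card ?U + (card X)\<^sup>2 * K" using insert by auto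
    have "E `` {x} \<inter> ?U = (\<Union>y\<in>X. E `` {x} \<inter> E `` {y})" by blast
    then have "card (E `` {x} \<inter> ?U) \<le> (\<Sum>y\<in>X. card (E `` {x} \<inter> E `` {y}))"
      by (simp only: card_UN_le[OF insert(1)])
    also have "\<dots> \<le> (\<Sum>y\<in>X. K)"
    proof (rule sum_mono)
      fix y assume "y \<in> X"
      then have "\<not> close K x y" "x \<noteq> y" using insert by auto
      then show "card (E `` {x} \<inter> E `` {y}) \<le> K" by (simp add: close_def)
    qed
    finally have "card (E `` {x} \<inter> ?U) \<le> card X * K" by simp
    moreover have "card (E `` {x}) + card ?U = card (E `` {x} \<union> ?U) + card (E `` {x} \<inter> ?U)"
      using card_Un_Int[OF finite_nbrs fU] .
    moreover have "\<delta> \<le> card (E `` {x})" using insert by simp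
    ultimately have "\<delta> + card X * \<delta> \<le> card (E `` {x} \<union> ?U) + card X * K + (card X)\<^sup>2 * K"
      using IH by linarith
    also have "\<dots> \<le> card (E `` {x} \<union> ?U) + (Suc (card X))\<^sup>2 * K"
      by (simp add: power2_eq_square algebra_simps)
    finally show ?case using insert(1,2) by simp
  qed simp
  moreover have "card (\<Union>x\<in>X. E `` {x}) \<le> card V"
    using nbrs_sub finite_V by (intro card_mono) auto
  ultimately show ?thesis by linarith
qed

end

text \<open>
  Both extremal degrees are at least \<open>card V / (4 * k)\<close>, and the degree bound enters the search for
  cycles of length \<open>2 * k + 1\<close> in this common form.
\<close>
locale dense_sgraph = sgraph +
  fixes k \<delta> :: nat
  assumes k3: "3 \<le> k" and large: "1000 * k ^ 8 \<le> card V"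
    and deg: "x \<in> V \<Longrightarrow> \<delta> \<le> card (E `` {x})"
    and dense: "card V \<le> 4 * k * \<delta>"
    and no_cycle: "is_cycle E p \<Longrightarrow> length p \<noteq> 2 * k + 1"
begin

text \<open>
  The threshold for closeness has to exceed \<open>4 * k\<close> times the length of a chain, in order to find that
  chain in a common neighbourhood, plus the number of vertices to be avoided; both are linear in \<open>k\<close>.
\<close>
definition K :: nat where "K = 10 * k ^ 2"

lemma delta_large: "250 * k ^ 7 \<le> \<delta>"
proof -
  have "4 * k * (250 * k ^ 7) = 1000 * k ^ 8" using power_Suc[of k 7] by simp
  then have "4 * k * (250 * k ^ 7) \<le> 4 * k * \<delta>" using large dense by linarith
  then show ?thesis using k3 mult_le_cancel1[of "4 * k"] by simp
qed

text \<open>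
  This covers all error terms that occur below: they come from at most \<open>4 * k + 2\<close> vertices with
  pairwise codegrees below \<open>K\<close>.
\<close>
lemma delta_gt: "2 * ((4 * k + 2)\<^sup>2 * K) + (4 * k + 2) * K + (4 * k + 2) < \<delta>"
proof -
  have "2 * ((4 * k + 2)\<^sup>2 * K) + (4 * k + 2) * K + (4 * k + 2)
      \<le> 2 * ((5 * k)\<^sup>2 * K) + 5 * k * K + 5 * k"
    using k3 by (intro add_mono mult_mono power_mono) simp_all
  also have "\<dots> = 500 * k ^ 4 + 50 * k ^ 3 + 5 * k"
    by (simp add: K_def power2_eq_square power3_eq_cube power4_eq_xxxx)
  also have "\<dots> \<le> 500 * k ^ 4 + 50 * k ^ 4 + 5 * k ^ 4"
    using k3 power_increasing[of 3 4 k] power_increasing[of 1 4 k]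
    by (intro add_mono mult_le_mono2) auto
  also have "\<dots> < 250 * k ^ 5"
  proof -
    have "k ^ 5 = k * k ^ 4" using power_Suc[of k 4] by simp
    moreover have "3 * k ^ 4 \<le> k * k ^ 4" using k3 by simp
    ultimately show ?thesis using k3 by simp
  qed
  also have "\<dots> \<le> 250 * k ^ 7" using k3 power_increasing[of 5 7 k] by simp
  finally show ?thesis using delta_large by simp
qed

text \<open>
  The neighbourhoods of \<open>4 * k + 1\<close> vertices have total size at least \<open>card V + \<delta>\<close>.
\<close>
lemma close_pair:
  assumes "X \<subseteq> V" "4 * k < card X"
  obtains x y where "x \<in> X" "y \<in> X" "close K x y"
proof (rule ccontr)
  assume no: "\<not> thesis"
  obtain Y where Y: "Y \<subseteq> X" "card Y = 4 * k + 1"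
    using obtain_subset_with_card_n[of "4 * k + 1" X] assms(2) by auto
  have "finite Y" using Y(2) by (metis add_eq_0_iff_both_eq_0 card.infinite one_neq_zero)
  then have "card Y * \<delta> \<le> card V + (card Y)\<^sup>2 * K"
    by (rule pairwise_not_close_count) (use no that Y(1) assms(1) deg in blast)+
  then have "\<delta> \<le> (4 * k + 1)\<^sup>2 * K" using dense by (simp add: Y(2) algebra_simps)
  also have "\<dots> \<le> (4 * k + 2)\<^sup>2 * K" by (intro mult_mono power_mono) auto
  finally show False using delta_gt by simp
qed

text \<open>
  The common neighbourhood of two close vertices contains a long chain of close vertices, which
  completes any short odd path between them to a cycle of length exactly \<open>2 * k + 1\<close>.
\<close>
lemma not_close_of_odd_path:
  assumes p: "is_path E x p z" "even (length p)" "length p \<le> 2 * k"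
  shows "\<not> close K x z"
proof
  assume cl: "close K x z"
  define B where "B = E `` {x} \<inter> E `` {z} - set p"
  have BV: "B \<subseteq> V" using nbrs_sub by (auto simp: B_def)
  have fB: "finite B" using BV finite_V by (rule finite_subset)
  \<comment> \<open>A chain of \<open>r + 1\<close> vertices expands to \<open>2 * r + 1\<close> vertices; with those of \<open>p\<close> they make \<open>2 * k + 1\<close>.\<close>
  define r where "r = k - length p div 2"
  have p2: "2 \<le> length p" using p(1,2) by (cases p) (auto simp: is_path_def intro: Suc_leI)
  have len: "length p + 2 * r = 2 * k" and r: "r < k"
    using p(2,3) p2 by (auto simp: r_def elim!: evenE)
  have large_B: "4 * k * r < card B"
  proof -
    have "card (set p) \<le> 2 * k" using card_length[of p] p(3) by simp
    then have "K \<le> card B + 2 * k"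
      using cl diff_card_le_card_Diff[OF finite_set, of "E `` {x} \<inter> E `` {z}" p]
      unfolding close_def B_def by linarith
    moreover have "4 * k * r \<le> 4 * k * k" using r by simp
    moreover have "K = 4 * k * k + 6 * k * k" by (simp add: K_def power2_eq_square)
    moreover have "2 * k < 6 * k * k" using k3 by simp
    ultimately show ?thesis by linarith
  qed
  obtain g :: "'a \<Rightarrow> nat" where g: "inj_on g B"
    using finite_imp_inj_to_nat_seg[OF fB] by blast
  have indep: "card I \<le> 4 * k"
    if I: "I \<subseteq> B" "\<And>x y. x \<in> I \<Longrightarrow> y \<in> I \<Longrightarrow> x \<noteq> y \<Longrightarrow> \<not> close K x y" for I
  proof (rule ccontr)
    assume "\<not> card I \<le> 4 * k"
    then obtain x y where "x \<in> I" "y \<in> I" "close K x y"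
      using close_pair[OF order.trans[OF I(1) BV]] by auto
    then show False using I(2) by (auto simp: close_def)
  qed
  have "\<exists>as. length as = Suc r \<and> set as \<subseteq> B \<and> sorted_wrt (\<lambda>x y. g x < g y) as
    \<and> successively (close K) as"
    by (rule ordered_path_of_small_independent_sets[OF fB g _ _ large_B])
      (rule indep, assumption, blast, rule close_sym, assumption)
  then obtain as where as: "length as = Suc r" "set as \<subseteq> B"
    "sorted_wrt (\<lambda>x y. g x < g y) as" "successively (close K) as" by blast
  have "distinct as"
    using as(3) by (induction as) auto
  moreover have "card (set p) + 2 * length as \<le> K"
  proof -
    have "card (set p) + 2 * length as \<le> 4 * k" using card_length[of p] as(1) len p2 by simp
    also have "\<dots> \<le> K" using k3 by (simp add: K_def power2_eq_square)
    finally show ?thesis .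
  qed
  moreover have "as \<noteq> []" "set as \<inter> set p = {}" using as by (auto simp: B_def)
  ultimately obtain q where q: "is_path E (hd as) q (last as)" "length q = 2 * length as - 1"
    "set q \<inter> set p = {}"
    using path_through_close_chain[of as K "set p"] as(4) by auto
  have "hd as \<in> B" "last as \<in> B" using as(2) \<open>as \<noteq> []\<close> by auto
  then have "(z, hd as) \<in> E" "(last as, x) \<in> E" using edge_sym by (auto simp: B_def)
  then have "is_cycle E (p @ q)"
    using p(1) q p2 as(1) by (intro is_path_join_cycle[of E x p z "hd as" q "last as"]) auto
  moreover have "length (p @ q) = 2 * k + 1" using len q(2) as(1) by simp
  ultimately show False using no_cycle by blast
qed

end

section \<open>A short odd cycle in a dense graph\<close>

locale dense_short_cycle = dense_sgraph V E k \<delta> + odd_girth_cycle V E v N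
  for V :: "'a set" and E k \<delta> v N +
  assumes N5: "5 \<le> N" and short: "N + 1 \<le> 2 * k"
begin

lemma less_K: "m \<le> 2 * k + 1 \<Longrightarrow> m < K"
proof -
  assume "m \<le> 2 * k + 1"
  also have "2 * k + 1 < 3 * k" using k3 by simp
  also have "\<dots> \<le> k * k" using k3 by simp
  also have "\<dots> \<le> K" by (simp add: K_def power2_eq_square)
  finally show ?thesis .
qed

text \<open>
  The odd arcs show that cycle vertices are pairwise not close. So only few neighbours of \<open>v i\<close> are
  also neighbours of another cycle vertex, and almost any neighbour can serve as \<open>u i\<close>.
\<close>
lemma obtain_pendants:
  obtains u where "\<And>i. i < N \<Longrightarrow> (v i, u i) \<in> E" "\<And>i. i < N \<Longrightarrow> u i \<notin> v ` {..<N}"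
    "\<And>i j. i < N \<Longrightarrow> j < N \<Longrightarrow> i \<noteq> j \<Longrightarrow> (u i, v j) \<notin> E"
proof -
  have "\<exists>u. (v i, u) \<in> E \<and> u \<notin> v ` {..<N} \<and> (\<forall>j<N. j \<noteq> i \<longrightarrow> (u, v j) \<notin> E)" if i: "i < N" for i
  proof -
    let ?J = "{..<N} - {i}"
    let ?U = "\<Union>j\<in>?J. E `` {v i} \<inter> E `` {v j}"
    have "card (E `` {v i} \<inter> E `` {v j}) \<le> K" if "j \<in> ?J" for j
    proof -
      obtain p where p: "is_path E (v i) p (v j)" "length p \<le> N" "even (length p) = True"
        using arc[of i j True] i \<open>j \<in> ?J\<close> by auto
      then have "\<not> close K (v i) (v j)" using short by (intro not_close_of_odd_path) auto
      moreover have "v i \<noteq> v j" using v_inj_on0 i \<open>j \<in> ?J\<close> by (auto dest: inj_onD)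
      ultimately show ?thesis by (simp add: close_def)
    qed
    then have "(\<Sum>j\<in>?J. card (E `` {v i} \<inter> E `` {v j})) \<le> (\<Sum>j\<in>?J. K)" by (intro sum_mono)
    moreover have "card ?U \<le> (\<Sum>j\<in>?J. card (E `` {v i} \<inter> E `` {v j}))"
      by (intro card_UN_le) simp
    moreover have "(\<Sum>j\<in>?J. K) \<le> N * K" using i by simp
    ultimately have U: "card ?U \<le> N * K" by linarith
    have "card (?U \<union> v ` {..<N}) \<le> N * K + N"
      using card_Un_le[of ?U "v ` {..<N}"] U card_image_le[of "{..<N}" v] by simp
    also have "\<dots> \<le> (4 * k + 2) * K + (4 * k + 2)"
      using short by (intro add_mono mult_mono) auto
    also have "\<dots> < card (E `` {v i})" using delta_gt deg[OF v_in_V[of i]] by linarith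
    finally have "\<not> E `` {v i} \<subseteq> ?U \<union> v ` {..<N}"
      using card_mono[of "?U \<union> v ` {..<N}" "E `` {v i}"] finite_nbrs by fastforce
    then obtain z where z: "(v i, z) \<in> E" "z \<notin> ?U" "z \<notin> v ` {..<N}" by auto
    then have "(z, v j) \<notin> E" if "j < N" "j \<noteq> i" for j using that edge_sym by auto
    with z show ?thesis by blast
  qed
  then obtain u where "\<forall>i. i < N \<longrightarrow> (v i, u i) \<in> E \<and> u i \<notin> v ` {..<N} \<and> (\<forall>j<N. j \<noteq> i \<longrightarrow> (u i, v j) \<notin> E)"
    by metis
  then show ?thesis using that by metis
qed

end

locale pendant_cycle = dense_short_cycle V E k \<delta> v N
  for V :: "'a set" and E k \<delta> v N +
  fixes u :: "nat \<Rightarrow> 'a"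
  assumes u_edge: "i < N \<Longrightarrow> (v i, u i) \<in> E" and u_off: "i < N \<Longrightarrow> u i \<notin> v ` {..<N}"
    and u_private: "i < N \<Longrightarrow> j < N \<Longrightarrow> i \<noteq> j \<Longrightarrow> (u i, v j) \<notin> E"
begin

text \<open>
  The boolean matches the sides of the complete bipartite graphs in the definition of \<open>BC\<close>, where the
  selected vertices have the value \<open>False\<close>.
\<close>
definition anchor :: "nat \<Rightarrow> bool \<Rightarrow> 'a" where
  "anchor i b = (if b then u i else v i)"

definition anchors :: "'a set" where
  "anchors = v ` {..<N} \<union> u ` {..<N}"

lemma pendant_off_cycle: "i < N \<Longrightarrow> j < N \<Longrightarrow> u i \<noteq> v j"
  using u_off by (metis imageI lessThan_iff)

lemma anchor_in_anchors: "i < N \<Longrightarrow> anchor i b \<in> anchors"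
  by (simp add: anchor_def anchors_def)

lemma anchors_cases:
  assumes "x \<in> anchors"
  obtains i b where "i < N" "x = anchor i b"
  using assms that[of _ True] that[of _ False] by (auto simp: anchors_def anchor_def)

lemma anchor_inj:
  assumes "i < N" "j < N"
  shows "anchor i b = anchor j c \<longleftrightarrow> i = j \<and> b = c"
proof -
  have "u i = u j \<longleftrightarrow> i = j"
    using u_private[OF assms] u_edge[OF assms(2)] edge_sym by metis
  moreover have "v i = v j \<longleftrightarrow> i = j" using v_inj_on0 assms by (auto dest: inj_onD)
  moreover have "u i \<noteq> v j" "v i \<noteq> u j" using pendant_off_cycle assms by metis+
  ultimately show ?thesis by (auto simp: anchor_def)
qed

lemma finite_anchors: "finite anchors" by (simp add: anchors_def)

lemma anchors_sub_V: "anchors \<subseteq> V"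
  using v_in_V u_edge E_sub by (auto simp: anchors_def)

lemma card_anchors: "card anchors = 2 * N"
proof -
  have "inj_on u {..<N}" using anchor_inj[of _ _ True True] by (auto simp: anchor_def inj_on_def)
  moreover have "v ` {..<N} \<inter> u ` {..<N} = {}" using pendant_off_cycle by force
  ultimately show ?thesis
    using v_inj_on0 by (simp add: anchors_def card_Un_disjoint card_image)
qed

text \<open>
  An arc of the right parity between \<open>v i\<close> and \<open>v j\<close> is extended by the pendant edges. The case
  \<open>i = j\<close> is different: the edge from \<open>v i\<close> to \<open>u i\<close> yields an odd path only.
\<close>
lemma path_between_anchors:
  assumes ij: "i < N" "j < N" "i \<noteq> j"
  obtains p where "is_path E (anchor i b) p (anchor j c)" "set p \<subseteq> anchors" "length p \<le> N + 2"
    "even (length p) = par"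
proof -
  have arcX: "\<exists>p. is_path E (v i) p (v j) \<and> set p \<subseteq> v ` {..<N} \<and> length p \<le> N \<and> even (length p) = e" for e
    by (rule arc[OF ij, of e]) blast
  have ui: "(u i, v i) \<in> E" "(v j, u j) \<in> E" using u_edge ij edge_sym by auto
  have off: "u i \<notin> v ` {..<N}" "u j \<notin> v ` {..<N}" "u i \<noteq> u j" 
    using u_off anchor_inj[of i j True True] ij by (auto simp: anchor_def)
  have "\<exists>p. is_path E (anchor i b) p (anchor j c) \<and> set p \<subseteq> anchors \<and> length p \<le> N + 2 \<and> even (length p) = par"
  proof (cases b; cases c)
    assume bc: b c
    obtain p where p: "is_path E (v i) p (v j)" "set p \<subseteq> v ` {..<N}" "length p \<le> N" "even (length p) = par"
      using arcX by blast
    have "is_path E (v i) (p @ [u j]) (u j)" using p off ui by (intro is_path_snoc) auto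
    then have "is_path E (u i) (u i # p @ [u j]) (u j)" using p off ui by (intro is_path_Cons) auto
    then show ?thesis using p bc ij by (intro exI[of _ "u i # p @ [u j]"]) (simp add: anchor_def anchors_def le_supI1)
  next
    assume bc: b "\<not> c"
    obtain p where p: "is_path E (v i) p (v j)" "set p \<subseteq> v ` {..<N}" "length p \<le> N" "even (length p) = (\<not> par)"
      using arcX by blast
    have "is_path E (u i) (u i # p) (v j)" using p off ui by (intro is_path_Cons) auto
    then show ?thesis using p bc ij by (intro exI[of _ "u i # p"]) (simp add: anchor_def anchors_def le_supI1)
  next
    assume bc: "\<not> b" c
    obtain p where p: "is_path E (v i) p (v j)" "set p \<subseteq> v ` {..<N}" "length p \<le> N" "even (length p) = (\<not> par)"
      using arcX by blast
    have "is_path E (v i) (p @ [u j]) (u j)" using p off ui by (intro is_path_snoc) auto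
    then show ?thesis using p bc ij by (intro exI[of _ "p @ [u j]"]) (simp add: anchor_def anchors_def le_supI1)
  next
    assume bc: "\<not> b" "\<not> c"
    obtain p where p: "is_path E (v i) p (v j)" "set p \<subseteq> v ` {..<N}" "length p \<le> N" "even (length p) = par"
      using arcX by blast
    then show ?thesis using bc by (intro exI[of _ p]) (simp add: anchor_def anchors_def le_supI1)
  qed
  then show ?thesis using that by blast
qed

lemma odd_path_between_anchors:
  assumes "i < N" "j < N" "(i, b) \<noteq> (j, c)"
  obtains p where "is_path E (anchor i b) p (anchor j c)" "set p \<subseteq> anchors" "length p \<le> N + 1"
    "even (length p)"
proof (cases "i = j")
  case False
  obtain p where "is_path E (anchor i b) p (anchor j c)" "set p \<subseteq> anchors" "length p \<le> N + 2" "even (length p)"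
    using path_between_anchors[of i j b c True] assms False by auto
  moreover have "length p \<noteq> N + 2" using \<open>even (length p)\<close> odd_N by (metis even_add even_numeral)
  ultimately show ?thesis using that[of p] by simp
next
  case True
  then have "(anchor i b, anchor j c) \<in> E" "anchor i b \<noteq> anchor j c"
    using assms u_edge edge_sym anchor_inj[of i j b c] by (auto simp: anchor_def)
  then show ?thesis
    using that[of "[anchor i b, anchor j c]"] N5 anchor_in_anchors assms by (auto simp: is_path_def)
qed

lemma anchors_not_close:
  assumes "x \<in> anchors" "y \<in> anchors"
  shows "\<not> close K x y"
proof (cases "x = y")
  case False
  obtain i b j c where ij: "i < N" "x = anchor i b" "j < N" "y = anchor j c"
    using assms anchors_cases by metis
  then have neq: "(i, b) \<noteq> (j, c)" using False by blast
  obtain p where "is_path E x p y" "even (length p)" "length p \<le> N + 1"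
    unfolding ij(2,4) by (rule odd_path_between_anchors[OF ij(1,3) neq])
  then show ?thesis using not_close_of_odd_path short by auto
qed (simp add: close_def)

text \<open>
  The neighbourhoods of the \<open>2 * N\<close> anchors are almost disjoint.
\<close>
lemma min_degree_bound_short: "2 * N * \<delta> \<le> card V + (4 * k + 2)\<^sup>2 * K"
proof -
  have "2 * N * \<delta> \<le> card V + (2 * N)\<^sup>2 * K"
    using pairwise_not_close_count[OF finite_anchors, of K \<delta>] anchors_not_close anchors_sub_V deg card_anchors by auto
  also have "(2 * N)\<^sup>2 * K \<le> (4 * k + 2)\<^sup>2 * K" using short by (intro mult_mono power_mono) auto
  finally show ?thesis by simp
qed

end

section \<open>The extremal structure around a short odd cycle\<close>

text \<open>
  The longest path used below to contradict closeness runs between two anchors, through at most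
  \<open>N + 2\<close> vertices, and continues with three further vertices; this is the reason for \<open>slack\<close>.
\<close>
locale extremal_pendant_cycle = pendant_cycle V E k \<delta> v N u
  for V :: "'a set" and E k \<delta> v N u +
  assumes slack: "N + 5 \<le> 2 * k" and extremal: "card V \<le> 2 * N * \<delta>"
begin

text \<open>
  Close vertices belong to the same side of the same complete bipartite graph in the extremal
  structure, so the vertices close to an anchor make up its side.
\<close>
definition side :: "nat \<Rightarrow> bool \<Rightarrow> 'a set" where
  "side i b = {w \<in> V. w = anchor i b \<or> close K w (anchor i b)}"

text \<open>
  A vertex outside all sides would be a further anchor, and the neighbourhoods of \<open>2 * N + 1\<close> vertices
  that are pairwise not close do not fit into \<open>V\<close>.
\<close>
lemma sides_cover:
  assumes "w \<in> V"
  obtains i b where "i < N" "w \<in> side i b"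
proof (rule ccontr)
  assume no: "\<not> thesis"
  note outer = that
  have out: "w \<noteq> anchor i b" "\<not> close K w (anchor i b)" if "i < N" for i b
    using no outer[OF that, of b] assms by (auto simp: side_def)
  have wX: "w \<notin> anchors" using out(1) anchors_cases by metis
  have nc: "\<not> close K w x" if "x \<in> anchors" for x using out(2) anchors_cases[OF that] by metis
  have "card (insert w anchors) * \<delta> \<le> card V + (card (insert w anchors))\<^sup>2 * K"
    using nc anchors_not_close close_sym anchors_sub_V assms deg finite_anchors
    by (intro pairwise_not_close_count) blast+
  then have "(2 * N + 1) * \<delta> \<le> card V + (2 * N + 1)\<^sup>2 * K" using wX finite_anchors card_anchors by simp
  then have "\<delta> \<le> (2 * N + 1)\<^sup>2 * K" using extremal by (simp add: algebra_simps)
  also have "\<dots> \<le> (4 * k + 2)\<^sup>2 * K" using short by (intro mult_mono power_mono) auto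
  finally show False using delta_gt by simp
qed

text \<open>
  If \<open>w\<close> is close to two anchors, an odd path between these, prolonged by two steps from the second
  anchor to \<open>w\<close>, is an odd path from the first anchor to \<open>w\<close>.
\<close>
lemma sides_disjoint:
  assumes "i < N" "j < N" "(i, b) \<noteq> (j, c)"
  shows "side i b \<inter> side j c = {}"
proof (rule ccontr)
  assume "\<not> ?thesis"
  then obtain w where w: "w \<in> side i b" "w \<in> side j c" by auto
  have neq: "anchor i b \<noteq> anchor j c" using anchor_inj assms by auto
  have cl: "close K w (anchor i b)" "close K w (anchor j c)"
    using w neq anchors_not_close anchor_in_anchors assms by (auto simp: side_def)
  then have wX: "w \<notin> anchors" using anchors_not_close anchor_in_anchors assms by blast
  obtain p where p: "is_path E (anchor i b) p (anchor j c)" "set p \<subseteq> anchors" "length p \<le> N + 1" "even (length p)"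
    by (rule odd_path_between_anchors[OF assms])
  have "card (set p) < K"
    using card_length[of p] p(3) short by (intro less_K) simp
  then obtain a where a: "(anchor j c, a) \<in> E" "(a, w) \<in> E" "a \<notin> set p"
    using common_neighbour_avoiding[OF close_sym[OF cl(2)], of "set p"] by auto
  have "is_path E (anchor i b) (p @ [a]) a" using p a by (intro is_path_snoc) auto
  then have "is_path E (anchor i b) ((p @ [a]) @ [w]) w"
    using a p wX no_loop by (intro is_path_snoc) auto
  then have "\<not> close K (anchor i b) w"
    by (rule not_close_of_odd_path) (use p slack in auto)
  then show False using cl close_sym by blast
qed

text \<open>
  Between the anchors of unmatched sides there is an even path inside the set of anchors. If \<open>w\<close> is
  not an anchor, prolong this path by two steps to \<open>w'\<close>, unless \<open>w'\<close> is the anchor already, and by the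
  edge to \<open>w\<close>. The result is an odd path between the close vertices \<open>anchor i b\<close> and \<open>w\<close>.
\<close>
lemma edge_between_unmatched_sides:
  assumes ij: "i < N" "j < N" and "w \<in> side i b" "w' \<in> side j c" and e: "(w, w') \<in> E"
    and unmatched: "\<not> (i = j \<and> b \<noteq> c)"
  shows "w = anchor i b"
proof (rule ccontr)
  assume "w \<noteq> anchor i b"
  then have cl: "close K w (anchor i b)" using assms(3) by (simp add: side_def)
  then have wX: "w \<notin> anchors" using anchors_not_close anchor_in_anchors ij by blast
  obtain p where p: "is_path E (anchor i b) p (anchor j c)" "set p \<subseteq> anchors" "length p \<le> N + 2" "odd (length p)"
  proof (cases "i = j")
    case True
    then have "b = c" using unmatched by simp
    then show ?thesis using that[of "[anchor i b]"] True is_path_single[of E "anchor i b"] anchor_in_anchors ij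
      by simp
  next
    case False
    then show ?thesis using that path_between_anchors[OF ij False, of b c False] by auto
  qed
  show False
  proof (cases "w' = anchor j c")
    case True
    then have "is_path E (anchor i b) (p @ [w]) w"
      using p wX e edge_sym by (intro is_path_snoc) auto
    then have "\<not> close K (anchor i b) w"
      by (rule not_close_of_odd_path) (use p slack in auto)
    then show False using cl close_sym by blast
  next
    case False
    then have cl': "close K w' (anchor j c)" using assms(4) by (simp add: side_def)
    then have wX': "w' \<notin> anchors" using anchors_not_close anchor_in_anchors ij by blast
    have "card (insert w (set p)) < K"
      using card_length[of p] p(3) slack card_insert_le_m1[of "2 * k + 1" "set p" w]
      by (intro less_K) simp
    then obtain a where a: "(anchor j c, a) \<in> E" "(a, w') \<in> E" "a \<notin> insert w (set p)"
      using common_neighbour_avoiding[OF close_sym[OF cl'], of "insert w (set p)"] by auto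
    have "is_path E (anchor i b) (p @ [a]) a" using p a by (intro is_path_snoc) auto
    then have "is_path E (anchor i b) ((p @ [a]) @ [w']) w'"
      using a p wX' no_loop by (intro is_path_snoc) auto
    then have "is_path E (anchor i b) (((p @ [a]) @ [w']) @ [w]) w"
      using a p wX e edge_sym no_loop by (intro is_path_snoc) auto
    then have "\<not> close K (anchor i b) w"
      by (rule not_close_of_odd_path) (use p slack in auto)
    then show False using cl close_sym by blast
  qed
qed

lemma edge_between_unmatched_anchors:
  assumes "i < N" "j < N" "w \<in> side i b" "w' \<in> side j c" "(w, w') \<in> E" "\<not> (i = j \<and> b \<noteq> c)"
  shows "w = anchor i b" "w' = anchor j c"
  using edge_between_unmatched_sides[OF assms]
    edge_between_unmatched_sides[OF assms(2,1,4,3)] assms(5,6) edge_sym by blast+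

lemma neighbour_in_side:
  assumes "i < N"
  obtains z where "(v i, z) \<in> E" "z \<notin> anchors" "z \<in> side i True"
proof -
  have "card anchors \<le> 4 * k" using card_anchors short by simp
  also have "\<dots> < \<delta>" using delta_gt by simp
  also have "\<dots> \<le> card (E `` {v i})" using deg v_in_V by simp
  finally have "\<not> E `` {v i} \<subseteq> anchors" using card_mono[OF finite_anchors, of "E `` {v i}"] by linarith
  then obtain z where z: "(v i, z) \<in> E" "z \<notin> anchors" by auto
  then have "z \<in> V" using E_sub by auto
  then obtain j c where j: "j < N" "z \<in> side j c" using sides_cover by blast
  have "v i \<in> side i False" using v_in_V by (simp add: side_def anchor_def)
  then have "i = j \<and> False \<noteq> c"
    using edge_between_unmatched_anchors(2)[OF assms j(1) _ j(2) z(1)] z(2) anchor_in_anchors[OF j(1)] by blast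
  then show ?thesis using that z j by simp
qed

text \<open>
  The pendant \<open>u i\<close> is an arbitrary private neighbour of \<open>v i\<close> and can be compared with another vertex
  \<open>z\<close> on its side that is adjacent to \<open>v i\<close>. An edge from \<open>u i\<close> to \<open>u j\<close> followed by \<open>v j\<close>, an even arc
  to \<open>v i\<close> and \<open>z\<close> is an odd path between the close vertices \<open>u i\<close> and \<open>z\<close>.
\<close>
lemma pendants_not_adjacent:
  assumes "i < N" "j < N"
  shows "(u i, u j) \<notin> E"
proof
  assume e: "(u i, u j) \<in> E"
  then have "i \<noteq> j" using no_loop by auto
  obtain z where z: "(v i, z) \<in> E" "z \<notin> anchors" "z \<in> side i True" using neighbour_in_side assms by blast
  then have cl: "close K z (u i)" using anchor_in_anchors[OF assms(1), of True] by (auto simp: side_def anchor_def)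
  obtain p where p: "is_path E (v j) p (v i)" "set p \<subseteq> v ` {..<N}" "length p \<le> N" "even (length p) = False"
    using arc[of j i False] assms \<open>i \<noteq> j\<close> by auto
  have "u i \<noteq> u j" using e no_loop by auto
  have off: "u i \<notin> set p" "u j \<notin> set p" using p(2) u_off assms by blast+
  have "is_path E (u j) (u j # p) (v i)"
    using p u_edge edge_sym off assms by (intro is_path_Cons) auto
  then have "is_path E (u i) (u i # u j # p) (v i)"
    using p e \<open>u i \<noteq> u j\<close> off by (intro is_path_Cons) auto
  then have "is_path E (u i) ((u i # u j # p) @ [z]) z"
    using p z assms by (intro is_path_snoc) (auto simp: anchors_def)
  then have "\<not> close K (u i) z"
    by (rule not_close_of_odd_path) (use p slack in auto)
  then show False using cl close_sym by blast
qed

text \<open>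
  Adjacent anchors of different indices can only be two cycle vertices: the pendants are private and
  pairwise not adjacent. As the cycle has no chords, they are then consecutive.
\<close>
lemma edge_cases:
  assumes "i < N" "j < N" "w \<in> side i b" "w' \<in> side j c" "(w, w') \<in> E"
  shows "i = j \<and> b \<noteq> c \<or> \<not> b \<and> \<not> c \<and> w = v i \<and> w' = v j \<and> (i, j) \<in> parcs (cycle_graph N)"
proof (cases "i = j \<and> b \<noteq> c")
  case False
  then have w: "w = anchor i b" "w' = anchor j c" using edge_between_unmatched_anchors assms by blast+
  have "i \<noteq> j" using False w assms(5) no_loop by auto
  then have "\<not> (u i, v j) \<in> E" "\<not> (v i, u j) \<in> E" "\<not> (u i, u j) \<in> E"
    using u_private pendants_not_adjacent assms edge_sym by blast+
  then have bc: "\<not> b" "\<not> c" using w assms(5) by (auto simp: anchor_def split: if_splits)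
  then have e: "(v i, v j) \<in> E" using w assms(5) by (simp add: anchor_def)
  have "j = i + 1 \<or> j + 1 = i + N" if "i < j" using chord[of i j] that assms e by auto
  moreover have "i = j + 1 \<or> i + 1 = j + N" if "j < i" using chord[of j i] that assms e edge_sym by auto
  ultimately have "j = i + 1 \<or> j + 1 = i + N \<or> i = j + 1 \<or> i + 1 = j + N" using \<open>i \<noteq> j\<close> by linarith
  then have "(i, j) \<in> parcs (cycle_graph N)"
    using assms(1,2) by (auto simp: cycle_graph_def)
  then show ?thesis using bc w by (simp add: anchor_def)
qed simp

lemma nbrs_sub_side:
  assumes "i < N" "w \<in> side i b" "b \<or> w \<noteq> v i"
  shows "E `` {w} \<subseteq> side i (\<not> b)"
proof
  fix y assume "y \<in> E `` {w}"
  then have y: "(w, y) \<in> E" "y \<in> V" using E_sub by auto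
  obtain j c where j: "j < N" "y \<in> side j c" using sides_cover[OF y(2)] .
  from edge_cases[OF assms(1) j(1) assms(2) j(2) y(1)] assms(3) j show "y \<in> side i (\<not> b)" by auto
qed

lemma finite_side: "finite (side i b)"
  using finite_V by (simp add: side_def)

lemma anchor_in_side: "i < N \<Longrightarrow> anchor i b \<in> side i b"
  using anchor_in_anchors anchors_sub_V by (auto simp: side_def)

text \<open>
  Each side contains the whole neighbourhood of a vertex on the opposite side. For the side of \<open>u i\<close>
  that vertex must differ from \<open>v i\<close>, whose neighbourhood includes cycle vertices; it exists because
  the opposite side has more than one element.
\<close>
lemma card_side_ge:
  assumes "i < N"
  shows "\<delta> \<le> card (side i b)"
proof -
  have ge: "\<delta> \<le> card (side i (\<not> c))" if w: "w \<in> side i c" "c \<or> w \<noteq> v i" for w c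
  proof -
    have "\<delta> \<le> card (E `` {w})" using w by (intro deg) (simp add: side_def)
    also have "\<dots> \<le> card (side i (\<not> c))"
      using nbrs_sub_side[OF assms w] finite_side by (intro card_mono)
    finally show ?thesis .
  qed
  have F: "\<delta> \<le> card (side i False)" using ge[OF anchor_in_side[OF assms, of True]] by simp
  have "1 < \<delta>" using delta_gt by simp
  with F have "\<not> side i False \<subseteq> {v i}" using card_mono[of "{v i}" "side i False"] by fastforce
  then obtain w where "w \<in> side i False" "w \<noteq> v i" by auto
  then have "\<delta> \<le> card (side i True)" using ge[of w False] by simp
  with F show ?thesis by (cases b) auto
qed

lemma side_partition:
  shows "(\<Union>(i, b)\<in>{..<N} \<times> UNIV. side i b) = V"
proof (intro equalityI subsetI)
  fix w assume "w \<in> V"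
  then obtain i b where "i < N" "w \<in> side i b" by (rule sides_cover)
  then show "w \<in> (\<Union>(i, b)\<in>{..<N} \<times> UNIV. side i b)" by blast
qed (auto simp: side_def)

lemma card_V: "card V = 2 * N * \<delta>" and card_side: "i < N \<Longrightarrow> card (side i b) = \<delta>"
proof -
  let ?I = "{..<N} \<times> (UNIV :: bool set)"
  have "card V = (\<Sum>(i, b)\<in>?I. card (side i b))"
  proof -
    have "card (\<Union>z\<in>?I. case_prod side z) = (\<Sum>z\<in>?I. card (case_prod side z))"
      using sides_disjoint finite_side by (intro card_UN_disjoint) auto
    then show ?thesis using side_partition by (simp add: case_prod_unfold)
  qed
  then have sum: "(\<Sum>z\<in>?I. card (case_prod side z)) = card V" by (simp add: case_prod_unfold)
  moreover have ge: "(\<Sum>z\<in>?I. \<delta>) \<le> (\<Sum>z\<in>?I. card (case_prod side z))"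
    using card_side_ge by (intro sum_mono) auto
  moreover have I: "(\<Sum>z\<in>?I. \<delta>) = 2 * N * \<delta>" by simp
  ultimately show cV: "card V = 2 * N * \<delta>" using extremal by linarith
  show "card (side i b) = \<delta>" if "i < N"
    using sum_mono_inv[of "\<lambda>_. \<delta>" ?I "\<lambda>z. card (case_prod side z)" "(i, b)"] sum cV I card_side_ge that
    by auto
qed

lemma side_complete:
  assumes "i < N" "w \<in> side i b" "w' \<in> side i (\<not> b)"
  shows "(w, w') \<in> E"
proof -
  have eq: "E `` {x} = side i (\<not> c)" if x: "x \<in> side i c" "c \<or> x \<noteq> v i" for x c
  proof (rule card_seteq[OF finite_side nbrs_sub_side[OF assms(1) x]])
    show "card (side i (\<not> c)) \<le> card (E `` {x})"
      using card_side[OF assms(1)] deg x by (simp add: side_def)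
  qed
  show ?thesis
  proof (cases b)
    case True
    then show ?thesis using eq[OF assms(2)] assms by auto
  next
    case False
    then show ?thesis using eq[OF assms(3)] assms edge_sym by auto
  qed
qed

lemma BC_extremal: "isomorphic \<lparr>pverts = V, parcs = E\<rparr> (BC N (card V))"
proof -
  have t: "card V div (2 * N) = \<delta>" using card_V N_pos by simp
  have delta0: "0 < \<delta>" using delta_gt by simp
  have "\<exists>h. bij_betw h (side i b) {..<\<delta>} \<and> h (anchor i b) = 0" if i: "i < N" for i b
  proof -
    obtain h where h: "bij_betw h (side i b) {..<\<delta>}"
      using ex_bij_betw_finite_nat[OF finite_side, of i b] card_side[OF i] by (auto simp: atLeast0LessThan)
    let ?c = "h (anchor i b)"
    have c: "?c < \<delta>" using h anchor_in_side[OF i, of b] by (auto dest: bij_betwE)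
    \<comment> \<open>The selected vertex of \<open>BC\<close> has number zero, so the anchor is swapped to that number.\<close>
    have "bij_betw (transpose 0 ?c) {..<\<delta>} {..<\<delta>}"
      using c delta0 by (intro bij_betw_transpose_iff) auto
    then have "bij_betw (transpose 0 ?c \<circ> h) (side i b) {..<\<delta>}" using h by (rule bij_betw_trans[rotated])
    then show ?thesis by (intro exI[of _ "transpose 0 ?c \<circ> h"]) simp
  qed
  then obtain h where h: "\<And>i b. i < N \<Longrightarrow> bij_betw (h i b) (side i b) {..<\<delta>}"
    "\<And>i b. i < N \<Longrightarrow> h i b (anchor i b) = 0" by metis
  have "\<forall>w. \<exists>z. w \<in> V \<longrightarrow> fst z < N \<and> w \<in> side (fst z) (snd z)"
    using sides_cover by (metis fst_conv snd_conv)
  then obtain cl where cl: "\<And>w. w \<in> V \<Longrightarrow> fst (cl w) < N" "\<And>w. w \<in> V \<Longrightarrow> w \<in> side (fst (cl w)) (snd (cl w))"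
    by metis
  have cl_eq: "cl w = (i, b)" if "i < N" "w \<in> side i b" for w i b
  proof -
    have "w \<in> V" using that by (simp add: side_def)
    then show ?thesis using sides_disjoint[of "fst (cl w)" i "snd (cl w)" b] cl[of w] that by auto
  qed
  define f where "f w = (fst (cl w), snd (cl w), h (fst (cl w)) (snd (cl w)) w)" for w
  let ?W = "{..<N} \<times> (UNIV :: bool set) \<times> {..<\<delta>}"
  have bij: "bij_betw f V ?W"
  proof (rule bij_betw_imageI)
    show "inj_on f V"
    proof (rule inj_onI)
      fix x y assume "x \<in> V" "y \<in> V" "f x = f y"
      then show "x = y"
        using cl[of x] cl[of y] bij_betw_imp_inj_on[OF h(1)[of "fst (cl x)" "snd (cl x)"]]
        by (auto simp: f_def dest: inj_onD)
    qed
    show "f ` V = ?W"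
    proof (intro equalityI subsetI)
      fix z assume "z \<in> f ` V"
      then show "z \<in> ?W" using cl bij_betwE[OF h(1)] by (auto simp: f_def)
    next
      fix z assume "z \<in> ?W"
      then obtain i b j where z: "z = (i, b, j)" "i < N" "j < \<delta>" by (cases z) auto
      then have "j \<in> h i b ` side i b" using h(1)[of i b] by (auto simp: bij_betw_def)
      then obtain w where w: "w \<in> side i b" "j = h i b w" by auto
      then have "w \<in> V" "f w = z" using cl_eq[OF z(2) w(1)] z by (auto simp: side_def f_def)
      then show "z \<in> f ` V" by blast
    qed
  qed
  have parcs: "parcs (BC N (card V)) = {((c, s, i), (d, r, j)). (c, s, i) \<in> ?W \<and> (d, r, j) \<in> ?W \<and> c = d \<and> s \<noteq> r} \<union>
         {((c, False, 0), (d, False, 0)) | c d.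
            (c, False, 0) \<in> ?W \<and> (d, False, 0) \<in> ?W \<and> (c, d) \<in> parcs (cycle_graph N)}"
    unfolding BC_def Let_def t by simp
  show ?thesis
  proof (rule isomorphicI[of _ _ f])
    show "bij_betw f (pverts \<lparr>pverts = V, parcs = E\<rparr>) (pverts (BC N (card V)))"
      using bij by (simp add: BC_def Let_def t)
  next
    fix x y assume "x \<in> pverts \<lparr>pverts = V, parcs = E\<rparr>" "y \<in> pverts \<lparr>pverts = V, parcs = E\<rparr>"
    then have xy: "x \<in> V" "y \<in> V" by auto
    obtain i b j c where ij: "cl x = (i, b)" "cl y = (j, c)" by (cases "cl x", cases "cl y") auto
    then have ijN: "i < N" "j < N" and xc: "x \<in> side i b" "y \<in> side j c"
      using cl[OF xy(1)] cl[OF xy(2)] by auto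
    have W: "(i, b, h i b x) \<in> ?W" "(j, c, h j c y) \<in> ?W"
      using bij_betwE[OF bij] xy ij by (auto simp: f_def)
    have zero: "h i b x = 0 \<longleftrightarrow> x = anchor i b" if "i < N" "x \<in> side i b" for i b x
      using h[OF that(1)] that(2) anchor_in_side[OF that(1)]
      by (metis bij_betw_imp_inj_on inj_onD)
    have "(x, y) \<in> E \<longleftrightarrow> i = j \<and> b \<noteq> c \<or> \<not> b \<and> \<not> c \<and> x = v i \<and> y = v j \<and> (i, j) \<in> parcs (cycle_graph N)"
    proof
      assume "(x, y) \<in> E"
      with edge_cases[OF ijN xc] show "i = j \<and> b \<noteq> c \<or> \<not> b \<and> \<not> c \<and> x = v i \<and> y = v j \<and> (i, j) \<in> parcs (cycle_graph N)"
        by blast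
    next
      have step: "(v a, v ((a + 1) mod N)) \<in> E" for a using v_edge[of a] v_mod[of "a + 1"] by simp
      assume "i = j \<and> b \<noteq> c \<or> \<not> b \<and> \<not> c \<and> x = v i \<and> y = v j \<and> (i, j) \<in> parcs (cycle_graph N)"
      then show "(x, y) \<in> E"
      proof
        assume "i = j \<and> b \<noteq> c"
        then have "j = i" "c = (\<not> b)" by auto
        with xc(2) have "y \<in> side i (\<not> b)" by simp
        then show ?thesis by (rule side_complete[OF ijN(1) xc(1)])
      next
        assume "\<not> b \<and> \<not> c \<and> x = v i \<and> y = v j \<and> (i, j) \<in> parcs (cycle_graph N)"
        then show ?thesis using step[of i] step[of j] edge_sym by (auto simp: cycle_graph_def)
      qed
    qed
    also have "\<dots> \<longleftrightarrow> i = j \<and> b \<noteq> c \<or> \<not> b \<and> \<not> c \<and> h i b x = 0 \<and> h j c y = 0 \<and> (i, j) \<in> parcs (cycle_graph N)"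
      using zero[OF ijN(1) xc(1)] zero[OF ijN(2) xc(2)] by (auto simp: anchor_def)
    also have "\<dots> \<longleftrightarrow> ((i, b, h i b x), (j, c, h j c y)) \<in> parcs (BC N (card V))"
      unfolding parcs using W by auto
    finally show "(x, y) \<in> parcs \<lparr>pverts = V, parcs = E\<rparr> \<longleftrightarrow> (f x, f y) \<in> parcs (BC N (card V))"
      using ij by (simp add: f_def)
  qed (use E_sub in \<open>auto simp: BC_def Let_def\<close>)
qed

end

section \<open>Both extremal results\<close>

context sgraph begin

text \<open>
  The hypothesis \<open>k \<le> 4 * l\<close> is \<open>l > (2 * k - 1) / 8\<close>, and \<open>4 * l < k\<close> is \<open>l < (2 * k - 1) / 8\<close>. They
  decide which of the two extremal degrees \<open>2 * n / (2 * k + 3)\<close> and \<open>n / (2 * (2 * l + 1))\<close> is the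
  larger one, and hence which graph is extremal.
\<close>
lemma odd_cycle_stability:
  assumes l2: "2 \<le> l" and lk: "l < k" and large: "1000 * k ^ 8 \<le> card V"
    and deg: "\<And>x. x \<in> V \<Longrightarrow> \<delta> \<le> card (E `` {x})"
    and no_short: "\<And>p i. is_cycle E p \<Longrightarrow> 1 \<le> i \<Longrightarrow> i \<le> l - 1 \<Longrightarrow> length p \<noteq> 2 * i + 1"
    and no_long: "\<And>p. is_cycle E p \<Longrightarrow> length p \<noteq> 2 * k + 1"
    and nonbip: "\<not> (\<exists>A B. A \<union> B = V \<and> A \<inter> B = {} \<and> E \<subseteq> A \<times> B \<union> B \<times> A)"
  shows "k \<le> 4 * l \<Longrightarrow> 2 * card V \<le> (2 * k + 3) * \<delta> \<Longrightarrow>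
      (2 * k + 3) * \<delta> = 2 * card V \<and> (2 * k + 3) dvd card V \<and>
      isomorphic \<lparr>pverts = V, parcs = E\<rparr> (blow_up (cycle_graph (2 * k + 3)) (card V div (2 * k + 3)))"
    and "4 * l < k \<Longrightarrow> card V \<le> 2 * (2 * l + 1) * \<delta> \<Longrightarrow>
      2 * (2 * l + 1) * \<delta> = card V \<and> isomorphic \<lparr>pverts = V, parcs = E\<rparr> (BC (2 * l + 1) (card V))"
proof -
  obtain j x where "odd j" "(x, x) \<in> E ^^ j" using two_colouring_or_odd_closed_walk[OF nonbip] by auto
  then obtain v N where cyc: "odd_girth_cycle V E v N" by (rule obtain_odd_girth_cycle)
  interpret odd_girth_cycle V E v N by (rule cyc)
  obtain m where m: "N = 2 * m + 1" using odd_N by (auto elim: oddE)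
  have "1 \<le> m" using N_ge_3 m by simp
  have "\<not> m \<le> l - 1" using no_short[OF v_cycle \<open>1 \<le> m\<close>] m by auto
  then have lm: "l \<le> m" by simp
  have mk: "m \<noteq> k" using no_long[OF v_cycle] m by simp
  have N5: "5 \<le> N" using lm l2 m by simp
  have V0: "0 < card V"
  proof -
    have "0 < 1000 * k ^ 8" using lk by simp
    then show ?thesis using large by linarith
  qed
  have bound: "k < m \<Longrightarrow> (2 * k + 3) * \<delta> \<le> N * \<delta> \<and> N * \<delta> \<le> 2 * card V"
    using min_degree_bound[OF N5 deg] mult_le_mono1[of "2 * k + 3" N \<delta>] m by simp
  have pend: "\<exists>u. pendant_cycle V E k \<delta> v N u" if "m < k" "card V \<le> 4 * k * \<delta>"
  proof -
    interpret dense_short_cycle V E k \<delta> v N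
      using l2 lk large deg that no_long N5 m by unfold_locales auto
    obtain u where "\<And>i. i < N \<Longrightarrow> (v i, u i) \<in> E" "\<And>i. i < N \<Longrightarrow> u i \<notin> v ` {..<N}"
      "\<And>i j. i < N \<Longrightarrow> j < N \<Longrightarrow> i \<noteq> j \<Longrightarrow> (u i, v j) \<notin> E" by (rule obtain_pendants) blast
    then have "pendant_cycle V E k \<delta> v N u" by unfold_locales
    then show ?thesis by blast
  qed
  show "(2 * k + 3) * \<delta> = 2 * card V \<and> (2 * k + 3) dvd card V \<and>
      isomorphic \<lparr>pverts = V, parcs = E\<rparr> (blow_up (cycle_graph (2 * k + 3)) (card V div (2 * k + 3)))"
    if kl: "k \<le> 4 * l" and d: "2 * card V \<le> (2 * k + 3) * \<delta>"
  proof (cases "k < m")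
    case True
    have \<delta>0: "0 < \<delta>" using d V0 by (cases \<delta>) auto
    have eq: "(2 * k + 3) * \<delta> = N * \<delta>" "N * \<delta> = 2 * card V" using bound[OF True] d by linarith+
    then have "(2 * k + 3) * \<delta> = N * \<delta>" by simp
    then have "N = 2 * k + 3" using \<delta>0 by (metis mult_right_cancel less_not_refl2)
    then show ?thesis using blow_up_extremal[OF N5 deg eq(2)] eq(2) by simp
  next
    case False
    then have mk': "m < k" using mk by simp
    have "(2 * k + 3) * \<delta> \<le> 8 * k * \<delta>" using lk l2 by (intro mult_le_mono1) simp
    then have "card V \<le> 4 * k * \<delta>" using d by linarith
    then obtain u where "pendant_cycle V E k \<delta> v N u" using pend[OF mk'] by auto
    then interpret pendant_cycle V E k \<delta> v N u .
    have "8 * l + 4 \<le> 4 * N" using lm m by simp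
    then have "(8 * l + 4) * \<delta> \<le> 4 * N * \<delta>" by (rule mult_le_mono1)
    then have "(8 * l + 4) * \<delta> \<le> 2 * (2 * N * \<delta>)" by simp
    moreover have "(2 * k + 3) * \<delta> \<le> (8 * l + 3) * \<delta>" using kl by (intro mult_le_mono1) simp
    ultimately have "(8 * l + 4) * \<delta> \<le> (8 * l + 3) * \<delta> + 2 * ((4 * k + 2)\<^sup>2 * K)"
      using min_degree_bound_short d by linarith
    then have "\<delta> \<le> 2 * ((4 * k + 2)\<^sup>2 * K)" by (simp add: algebra_simps)
    then show ?thesis using delta_gt by linarith
  qed
  show "2 * (2 * l + 1) * \<delta> = card V \<and> isomorphic \<lparr>pverts = V, parcs = E\<rparr> (BC (2 * l + 1) (card V))"
    if kl: "4 * l < k" and d: "card V \<le> 2 * (2 * l + 1) * \<delta>"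
  proof (cases "k < m")
    case True
    have \<delta>0: "0 < \<delta>" using d V0 by (cases \<delta>) auto
    have "(2 * k + 3) * \<delta> \<le> 4 * (2 * l + 1) * \<delta>" using bound[OF True] d by linarith
    then have "2 * k + 3 \<le> 4 * (2 * l + 1)" using \<delta>0 by simp
    then show ?thesis using kl by simp
  next
    case False
    then have mk': "m < k" using mk by simp
    have "2 * (2 * l + 1) * \<delta> \<le> 4 * k * \<delta>" using lk by (intro mult_le_mono1) simp
    then obtain u where "pendant_cycle V E k \<delta> v N u" using pend[OF mk'] d by auto
    then interpret P: pendant_cycle V E k \<delta> v N u .
    have "2 * N * \<delta> < 2 * (2 * l + 1) * \<delta> + \<delta>"
      using P.min_degree_bound_short P.delta_gt d by linarith
    also have "\<dots> = (2 * (2 * l + 1) + 1) * \<delta>" by simp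
    finally have "2 * N < 2 * (2 * l + 1) + 1" by (metis mult_less_cancel2)
    then have N: "N = 2 * l + 1" using lm m by simp
    interpret extremal_pendant_cycle V E k \<delta> v N u
      using N kl l2 d by unfold_locales auto
    show ?thesis using card_V BC_extremal N by simp
  qed
qed

end

lemma min_degree_le:
  assumes "finite (pverts G)" "x \<in> pverts G"
  shows "min_degree G \<le> card (parcs G `` {x})"
proof -
  have "min_degree G \<le> out_degree (with_proj G) x"
    unfolding min_degree_def using assms by (intro Min_le) auto
  also have "out_arcs (with_proj G) x = Pair x ` (parcs G `` {x})"
    by (auto simp: out_arcs_def)
  then have "out_degree (with_proj G) x = card (parcs G `` {x})"
    by (simp add: out_degree_def card_image inj_on_def)
  finally show ?thesis .
qed

lemma pair_graph_imp_sgraph: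
  assumes "pair_graph G"
  shows "sgraph (pverts G) (parcs G)"
proof -
  interpret pair_graph G by fact
  show ?thesis
  proof
    show "parcs G \<subseteq> pverts G \<times> pverts G" using wellformed' by auto
    show "sym (parcs G)" using pair_sym_arcs by (simp add: symmetric_def)
    show "irrefl (parcs G)" using pair_no_loops by (fastforce simp: irrefl_def)
  qed (rule pair_finite_verts)
qed

theorem theorem1p6:
  fixes l k n :: nat and G :: "'a pair_pre_digraph"
  assumes "2 \<le> l" and "l < k" and "n \<ge> 1000 * k ^ 8"
    and "pair_graph G" and "card (pverts G) = n"
    and "family_free (odd_cycle_family l k) G"
  shows "(real l > (2 * real k - 1) / 8 \<and> real (min_degree G) \<ge> 2 * real n / (2 * real k + 3) \<longrightarrow>
            bipartite G \<or>
            (real (min_degree G) = 2 * real n / (2 * real k + 3) \<and> (2 * k + 3) dvd n \<and>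
             isomorphic G (blow_up (cycle_graph (2 * k + 3)) (n div (2 * k + 3))))) \<and>
         (real l < (2 * real k - 1) / 8 \<and> real (min_degree G) \<ge> real n / (2 * (2 * real l + 1)) \<longrightarrow>
            bipartite G \<or>
            (real (min_degree G) = real n / (2 * (2 * real l + 1)) \<and> (2 * (2 * l + 1)) dvd n \<and>
             isomorphic G (BC (2 * l + 1) n)))"
proof -
  interpret sgraph "pverts G" "parcs G" using assms(4) by (rule pair_graph_imp_sgraph)
  let ?\<delta> = "min_degree G"
  have G_eq: "\<lparr>pverts = pverts G, parcs = parcs G\<rparr> = G" by simp
  have free: "cycle_graph (length p) \<notin> odd_cycle_family l k" if "is_cycle (parcs G) p" for p
    using contains_cycleI[OF E_sub sym_E that] assms(6) by (auto simp: family_free_def)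
  have no_short: "length p \<noteq> 2 * i + 1" if "is_cycle (parcs G) p" "1 \<le> i" "i \<le> l - 1" for p i
    using free[OF that(1)] that(2,3) by (auto simp: odd_cycle_family_def)
  have no_long: "length p \<noteq> 2 * k + 1" if "is_cycle (parcs G) p" for p
    using free[OF that] by (auto simp: odd_cycle_family_def)
  note stability = odd_cycle_stability[OF assms(1,2) _ min_degree_le[OF finite_V] no_short no_long, simplified assms(5) G_eq, OF assms(3)]
  show ?thesis
  proof (intro conjI impI)
    assume h: "(2 * real k - 1) / 8 < real l \<and> 2 * real n / (2 * real k + 3) \<le> real ?\<delta>"
    then have "real (2 * k) < real (8 * l + 1)" by simp
    then have kl: "k \<le> 4 * l" by (simp only: of_nat_less_iff)
    from h have "real (2 * n) \<le> real ((2 * k + 3) * ?\<delta>)" by (simp add: field_simps)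
    then have d: "2 * n \<le> (2 * k + 3) * ?\<delta>" by (simp only: of_nat_le_iff)
    show "bipartite G \<or> (real ?\<delta> = 2 * real n / (2 * real k + 3) \<and> (2 * k + 3) dvd n \<and>
        isomorphic G (blow_up (cycle_graph (2 * k + 3)) (n div (2 * k + 3))))"
    proof (intro disj_imp[THEN iffD2] impI)
      assume "\<not> bipartite G"
      then have res: "(2 * k + 3) * ?\<delta> = 2 * n" "(2 * k + 3) dvd n"
        "isomorphic G (blow_up (cycle_graph (2 * k + 3)) (n div (2 * k + 3)))"
        using stability(1) kl d by (auto simp: bipartite_def)
      from res(1) have "real ((2 * k + 3) * ?\<delta>) = real (2 * n)" by (rule arg_cong)
      then show "real ?\<delta> = 2 * real n / (2 * real k + 3) \<and> (2 * k + 3) dvd n \<and>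
        isomorphic G (blow_up (cycle_graph (2 * k + 3)) (n div (2 * k + 3)))"
        using res(2,3) by (simp add: field_simps)
    qed
  next
    assume h: "real l < (2 * real k - 1) / 8 \<and> real n / (2 * (2 * real l + 1)) \<le> real ?\<delta>"
    then have "real (8 * l + 1) < real (2 * k)" by simp
    then have kl: "4 * l < k" by (simp only: of_nat_less_iff)
    from h have "real n \<le> real (2 * (2 * l + 1) * ?\<delta>)" by (simp add: field_simps)
    then have d: "n \<le> 2 * (2 * l + 1) * ?\<delta>" by (simp only: of_nat_le_iff)
    show "bipartite G \<or> (real ?\<delta> = real n / (2 * (2 * real l + 1)) \<and> (2 * (2 * l + 1)) dvd n \<and>
        isomorphic G (BC (2 * l + 1) n))"
    proof (intro disj_imp[THEN iffD2] impI)
      assume "\<not> bipartite G"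
      then have res: "2 * (2 * l + 1) * ?\<delta> = n" "isomorphic G (BC (2 * l + 1) n)"
        using stability(2) kl d by (auto simp: bipartite_def)
      from res(1) have "real (2 * (2 * l + 1) * ?\<delta>) = real n" by (rule arg_cong)
      moreover have "2 * (2 * l + 1) dvd n" using res(1) by (metis dvd_triv_left)
      ultimately show "real ?\<delta> = real n / (2 * (2 * real l + 1)) \<and> (2 * (2 * l + 1)) dvd n \<and>
        isomorphic G (BC (2 * l + 1) n)"
        using res(2) by (simp add: field_simps)
    qed
  qed
qed

end
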